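(* For all $(\mu|\lambda),(\alpha|\nu)\in\Sigma$, the almost symmetric Kostka coefficient satisfies $$K_{(\alpha|\nu)}^{(\mu|\lambda)}\in\mathbb{Z}_{\ge0}.$$
   Context: **Combinatorics.** A composition is a finite tuple $\mu=(\mu_1,\ldots,\mu_n)$ of non-negative integers (the empty one $\emptyset$ is allowed); $\ell(\mu)=n$. It is reduced if $\mu=\emptyset$ or $\mu_{\ell(\mu)}\neq 0$. A partition is a composition with $\lambda_1\ge\dots\ge\lambda_n\ge1$ ($\emptyset$ allowed). $\Sigma$ is the set of pairs $(\mu|\lambda)$ with $\mu$ a reduced composition and $\lambda$ a partition. $*$ denotes concatenation. **Almost symmetric functions.** $\mathscr{P}_n^+=\mathbb{Q}(q,t)[x_1,\ldots,x_n]$; $\mathscr{P}(k)^+=\mathbb{Q}(q,t)[x_1,\ldots,x_k]\otimes\Lambda[\mathfrak{X}_k]$, where $\Lambda[\mathfrak{X}_k]$ is the ring of symmetric functions in $\mathfrak{X}_k=x_{k+1}+x_{k+2}+\cdots$, i.e. in the variables $x_{k+1},x_{k+2},\ldots$; $\mathscr{P}_{as}^+=\bigcup_{k\ge0}\mathscr{P}(k)^+$. **Key polynomials.** $\xi_i(f)=\frac{x_if-x_{i+1}s_i(f)}{x_i-x_{i+1}}$, where $s_i$ swaps $x_i,x_{i+1}$. The key polynomials $\mathcal{K}_\alpha(x_1,\ldots,x_n)$, $\alpha\in\mathbb{Z}_{\ge0}^n$, are determined by: $\mathcal{K}_\alpha=x^\alpha$ if $\alpha_1\ge\dots\ge\alpha_n$;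 and $\mathcal{K}_{s_i(\alpha)}=\xi_i(\mathcal{K}_\alpha)$ if $\alpha_i>\alpha_{i+1}$ ($s_i(\alpha)$ swaps entries $i,i+1$). One has $\mathcal{K}_{\alpha*0}=\mathcal{K}_\alpha$. **Almost symmetric Schur functions.** Let $\mathfrak{S}_{(1^k,n-k)}\subset\mathfrak{S}_n$ be the permutations fixing $1,\ldots,k$. For $0\le k\le n$, $$W_k^{(n)}(f)=\sum_{\sigma\in\mathfrak{S}_{(1^k,n-k)}}\sigma\Big(f\prod_{k+1\le i<j\le n}\frac1{1-x_j/x_i}\Big),\qquad f\in\mathscr{P}_n^+,$$ with $\sigma$ permuting variables. These operators are compatible with setting $x_{n+1}=0$, and $W_k=\lim_nW_k^{(n)}$ is the operator on $\mathscr{P}_{as}^+$ such that $W_k(f)(x_1,\ldots,x_n,0,0,\ldots)=W_k^{(n)}(f(x_1,\ldots,x_n,0,0,\ldots))$ for all $n\ge k$. The functions $s_{(\mu|\lambda)}$, $(\mu|\lambda)\in\Sigma$, are defined recursively by $s_{(\mu|\emptyset)}=\mathcal{K}_\mu$, and, if $\mu_r\ge\lambda_1$ (and $(\mu_1,\ldots,\mu_{r-1})$ is reduced), $s_{(\mu_1,\ldots,\mu_{r-1}|\mu_r,\lambda_1,\ldots,\lambda_\ell)}=W_{r-1}\big(s_{(\mu_1,\ldots,\mu_r|\lambda_1,\ldots,\lambda_\ell)}\big)$. One has $s_{(\mu|\lambda)}\in\mathscr{P}(\ell(\mu))^+$. **Almost symmetric Kostka coefficients.** With $m_\nu$ the monomial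 symmetric functions, $\{x^\alpha m_\nu[\mathfrak{X}_k]:(\alpha|\nu)\in\Sigma,\ \ell(\alpha)\le k\}$ is a basis of $\mathscr{P}(k)^+$. The $K_{(\alpha|\nu)}^{(\mu|\lambda)}$ are defined by $$s_{(\mu|\lambda)}=\sum_{(\alpha|\nu)\in\Sigma,\ \ell(\alpha)\le\ell(\mu)}K_{(\alpha|\nu)}^{(\mu|\lambda)}\,x^\alpha m_\nu[\mathfrak{X}_{\ell(\mu)}],$$ and $K_{(\alpha|\nu)}^{(\mu|\lambda)}=0$ if $\ell(\alpha)>\ell(\mu)$. *)

theory Defs
  imports
    "HOL-Library.Poly_Mapping"
    "HOL-Library.Multiset"
    "HOL-Combinatorics.Permutations"
    "HOL-Computational_Algebra.Polynomial_Factorial"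
begin

text \<open>
  Indices are shifted by one: the variable written $x_{i+1}$ on paper is the one with index \<open>i\<close>
  here.  So \<open>x\<^sub>1, \<dots>, x\<^sub>n\<close> are the indices in \<open>{..<n}\<close>, the alphabet
  \<open>\<XX>\<^sub>k = x\<^bsub>k+1\<^esub> + x\<^bsub>k+2\<^esub> + \<dots>\<close> is \<open>{k..}\<close>, and the group
  of permutations of \<open>{1..n}\<close> fixing \<open>1, \<dots>, k\<close> is \<open>{\<sigma>. \<sigma> permutes {k..<n}}\<close>.
\<close>

section \<open>Compositions and partitions\<close>

definition reduced :: "nat list \<Rightarrow> bool" where
  "reduced \<mu> \<longleftrightarrow> \<mu> = [] \<or> last \<mu> \<noteq> 0"

definition is_partition :: "nat list \<Rightarrow> bool" where
  "is_partition \<nu> \<longleftrightarrow> sorted_wrt (\<ge>) \<nu> \<and> (\<forall>a\<in>set \<nu>. a \<ge> 1)"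

definition Sigma_as :: "(nat list \<times> nat list) set" where
  "Sigma_as = {(\<mu>, \<nu>). reduced \<mu> \<and> is_partition \<nu>}"

section \<open>Polynomials and rational functions\<close>

text \<open>\<open>qt\<close> is the field $\mathbb{Q}(q,t)$, as the fraction field of $\mathbb{Q}[q][t]$.\<close>

type_synonym qt = "rat poly poly fract"
type_synonym monom = "nat \<Rightarrow>\<^sub>0 nat"
type_synonym mpoly = "monom \<Rightarrow>\<^sub>0 qt"
type_synonym ratfun = "mpoly fract"

definition polys :: "nat \<Rightarrow> mpoly set" where
  "polys n = {f. \<forall>m \<in> Poly_Mapping.keys f. Poly_Mapping.keys m \<subseteq> {..<n}}"

definition X :: "nat \<Rightarrow> mpoly" where
  "X i = Poly_Mapping.single (Poly_Mapping.single i 1) 1"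

definition x_pow :: "nat list \<Rightarrow> mpoly" where
  "x_pow \<alpha> = Poly_Mapping.single (Poly_Mapping.nth \<alpha>) 1"

text \<open>
  The substitution \<open>x\<^sub>i \<mapsto> x\<^bsub>\<sigma> i\<^esub>\<close> for a bijection \<open>\<sigma>\<close>: the coefficient of the monomial with
  exponents \<open>e\<close> in \<open>perm_poly \<sigma> f\<close> is the one of the monomial with exponents \<open>e \<circ> \<sigma>\<close> in \<open>f\<close>.
\<close>

definition perm_poly :: "(nat \<Rightarrow> nat) \<Rightarrow> mpoly \<Rightarrow> mpoly" where
  "perm_poly \<sigma> f = Poly_Mapping.map_key (Poly_Mapping.map_key \<sigma>) f"

definition perm_ratfun :: "(nat \<Rightarrow> nat) \<Rightarrow> ratfun \<Rightarrow> ratfun" where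
  "perm_ratfun \<sigma> r =
    (THE s. \<exists>a b. b \<noteq> 0 \<and> r = Fract a b \<and> s = Fract (perm_poly \<sigma> a) (perm_poly \<sigma> b))"

text \<open>A rational function that is known to be a polynomial, read as a polynomial.\<close>

definition poly_of_ratfun :: "ratfun \<Rightarrow> mpoly" where
  "poly_of_ratfun r = (THE f. to_fract f = r)"

section \<open>Key polynomials\<close>

definition xi :: "nat \<Rightarrow> mpoly \<Rightarrow> mpoly" where
  "xi i f = poly_of_ratfun
    (to_fract (X i * f - X (Suc i) * perm_poly (Transposition.transpose i (Suc i)) f)
      / to_fract (X i - X (Suc i)))"

inductive is_key :: "nat list \<Rightarrow> mpoly \<Rightarrow> bool" where
  dominant: "sorted_wrt (\<ge>) \<alpha> \<Longrightarrow> is_key \<alpha> (x_pow \<alpha>)"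
| swap: "is_key \<alpha> f \<Longrightarrow> Suc i < length \<alpha> \<Longrightarrow> \<alpha> ! i > \<alpha> ! Suc i \<Longrightarrow>
    is_key (\<alpha>[i := \<alpha> ! Suc i, Suc i := \<alpha> ! i]) (xi i f)"

definition key_poly :: "nat list \<Rightarrow> mpoly" where
  "key_poly \<alpha> = (THE f. is_key \<alpha> f)"

section \<open>Almost symmetric functions\<close>

text \<open>
  Almost symmetric functions are formal power series in countably many variables, given by their
  coefficients; a polynomial \<open>f\<close> is the series \<open>lookup f\<close>.
\<close>

type_synonym series = "monom \<Rightarrow> qt"

definition series_mult :: "series \<Rightarrow> series \<Rightarrow> series" where
  "series_mult f g = (\<lambda>m. \<Sum>(a, b) \<in> {(a, b). a + b = m}. f a * g b)"

definition total_degree :: "monom \<Rightarrow> nat" where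
  "total_degree m = (\<Sum>i\<in>Poly_Mapping.keys m. Poly_Mapping.lookup m i)"

text \<open>The ring $\Lambda[\mathfrak{X}_k]$ of symmetric functions in the variables of index \<open>\<ge> k\<close>:
  series of bounded degree, invariant under finitary permutations of these variables.\<close>

definition Lambda :: "nat \<Rightarrow> series set" where
  "Lambda k = {g.
    (\<exists>d. \<forall>m. g m \<noteq> 0 \<longrightarrow> total_degree m \<le> d) \<and>
    (\<forall>m. g m \<noteq> 0 \<longrightarrow> Poly_Mapping.keys m \<subseteq> {k..}) \<and>
    (\<forall>n \<sigma> m. \<sigma> permutes {k..<n} \<longrightarrow> g (Poly_Mapping.map_key \<sigma> m) = g m)}"

text \<open>$\mathscr{P}(k)^+$: finite sums of products of elements of the two tensor factors.\<close>

definition P_k :: "nat \<Rightarrow> series set" where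
  "P_k k = {\<lambda>m. \<Sum>j<N. series_mult (Poly_Mapping.lookup (p j)) (g j) m | (N::nat) p g.
    \<forall>j<N. p j \<in> polys k \<and> g j \<in> Lambda k}"

definition P_as :: "series set" where
  "P_as = (\<Union>k. P_k k)"

text \<open>\<open>truncate n f\<close> is \<open>f(x\<^sub>1, \<dots>, x\<^sub>n, 0, 0, \<dots>)\<close>, a polynomial whenever \<open>f\<close> has bounded degree.\<close>

definition truncate :: "nat \<Rightarrow> series \<Rightarrow> mpoly" where
  "truncate n f = Abs_poly_mapping (\<lambda>m. if Poly_Mapping.keys m \<subseteq> {..<n} then f m else 0)"

section \<open>Almost symmetric Schur functions\<close>

definition W_fin :: "nat \<Rightarrow> nat \<Rightarrow> mpoly \<Rightarrow> mpoly" where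
  "W_fin k n f = poly_of_ratfun
    (\<Sum>\<sigma> | \<sigma> permutes {k..<n}.
      perm_ratfun \<sigma> (to_fract f *
        (\<Prod>(i, j) \<in> {(i, j). k \<le> i \<and> i < j \<and> j < n}.
          1 / (1 - to_fract (X j) / to_fract (X i)))))"

definition W :: "nat \<Rightarrow> series \<Rightarrow> series" where
  "W k f = (THE g. g \<in> P_as \<and> (\<forall>n\<ge>k. truncate n g = W_fin k n (truncate n f)))"

text \<open>
  For \<open>(\<mu> @ [a] | \<nu>)\<close> with \<open>(\<mu>, a # \<nu>) \<in> Sigma_as\<close>, the side conditions of the recursion
  (\<open>a\<close> is at least the first part of \<open>\<nu>\<close>, and \<open>\<mu>\<close> is reduced) hold automatically, and
  \<open>(\<mu> @ [a], \<nu>) \<in> Sigma_as\<close>.  Outside \<open>Sigma_as\<close> the values are irrelevant.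
\<close>

fun schur_as :: "nat list \<Rightarrow> nat list \<Rightarrow> series" where
  "schur_as \<mu> [] = Poly_Mapping.lookup (key_poly \<mu>)"
| "schur_as \<mu> (a # \<nu>) = W (length \<mu>) (schur_as (\<mu> @ [a]) \<nu>)"

section \<open>Almost symmetric Kostka coefficients\<close>

text \<open>$m_\nu[\mathfrak{X}_k]$: the sum of all distinct monomials in the variables of index \<open>\<ge> k\<close>
  whose nonzero exponents are, up to order, the parts of \<open>\<nu>\<close>.\<close>

definition msym :: "nat list \<Rightarrow> nat \<Rightarrow> series" where
  "msym \<nu> k = (\<lambda>m. if Poly_Mapping.keys m \<subseteq> {k..} \<and>
      image_mset (Poly_Mapping.lookup m) (mset_set (Poly_Mapping.keys m)) = mset \<nu>
    then 1 else 0)"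

text \<open>All coefficients of \<open>s\<^bsub>(\<mu>|\<lambda>)\<^esub>\<close> at once; the support condition says in particular that the
  coefficient at \<open>(\<alpha>|\<nu>)\<close> vanishes for \<open>length \<alpha> > length \<mu>\<close>.\<close>

definition kostka_as :: "nat list \<times> nat list \<Rightarrow> nat list \<times> nat list \<Rightarrow> qt" where
  "kostka_as = (\<lambda>(\<mu>, lam). THE K.
    finite {p. K p \<noteq> 0} \<and>
    {p. K p \<noteq> 0} \<subseteq> {(\<alpha>, \<nu>) \<in> Sigma_as. length \<alpha> \<le> length \<mu>} \<and>
    schur_as \<mu> lam = (\<lambda>m. \<Sum>(\<alpha>, \<nu>) \<in> {p. K p \<noteq> 0}.
      K (\<alpha>, \<nu>) * series_mult (Poly_Mapping.lookup (x_pow \<alpha>)) (msym \<nu> (length \<mu>)) m))"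

end

theory Submission
  imports Defs
begin

text \<open>
  The monomials \<open>x\<^sup>\<alpha> m\<^sub>\<nu>\<close> of the basis of \<open>P_k k\<close> have disjoint supports and coefficients \<open>1\<close>, so an
  almost symmetric Kostka coefficient is simply one of the coefficients of the power series
  \<open>schur_as \<mu> lam\<close> (\<open>kostka_as_eq\<close>).  The theorem thus says that this series has non-negative integer
  coefficients.

  The reason is that its truncation to \<open>n\<close> variables is a key polynomial as soon as \<open>n\<close> is large
  enough (\<open>schur_as_limit_of_key_polys\<close>).  Indeed, the finite symmetrizing operator \<open>W_fin k n\<close>
  is a product of isobaric divided differences \<open>xi i\<close> along a reduced word of the longest
  permutation of the variables with index in \<open>{k..<n}\<close> (\<open>W_fin_eq_symmetrizer\<close>): the symmetrizing sum
  takes the same value at \<open>f\<close> and at \<open>xi i f\<close>, it is linear over the polynomials that are symmetric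
  in these variables, and it maps \<open>1\<close> to \<open>1\<close>.  Each \<open>xi i\<close> sends a key polynomial either to itself
  or to another one (\<open>xi_key_poly_le\<close>, \<open>xi_key_poly_ge\<close>).  The same description of \<open>W_fin\<close>
  shows that it is compatible with setting the last variable to zero, so that the limit operators
  \<open>W k\<close> exist (\<open>W_limit\<close>).

  It remains to see that key polynomials have non-negative integer coefficients
  (\<open>nat_coeffs_key_poly\<close>).  This is done by induction on the degree, through an expansion
  \<open>key_poly \<alpha> = (\<Sum>(C, \<beta>). (\<Prod>i\<in>C. X i) * key_poly \<beta>)\<close> in which the compositions \<open>\<beta>\<close> have smaller size and
  every entry of \<open>\<beta>\<close> at a position in \<open>C\<close> is at least every entry at a position outside \<open>C\<close>.  Such an
  expansion is evident for a dominant \<open>\<alpha>\<close>.  It is preserved by the operators \<open>xi i\<close>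
  (\<open>xi_strip_cone\<close>) since
  \<open>xi i (X i * g) = X i * g + X (Suc i) * xi i g\<close>, while \<open>xi i (X (Suc i) * g) = 0\<close> if \<open>g\<close> is symmetric
  in \<open>X i\<close> and \<open>X (Suc i)\<close>; the condition on \<open>C\<close> and \<open>\<beta>\<close> guarantees this symmetry for all terms to which
  the second rule is applied.
\<close>

section \<open>Permuting variables\<close>

lemma poly_mapping_sum_singles:
  fixes f :: "'a \<Rightarrow>\<^sub>0 'b::comm_monoid_add"
  shows "(\<Sum>m\<in>Poly_Mapping.keys f. Poly_Mapping.single m (Poly_Mapping.lookup f m)) = f"
  by (rule poly_mapping_eqI) (auto simp: lookup_sum lookup_single when_def in_keys_iff)

lemma poly_mapping_induct [case_names single add]:
  fixes f :: "'a \<Rightarrow>\<^sub>0 'b::comm_monoid_add"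
  assumes single: "\<And>m c. P (Poly_Mapping.single m c)"
    and add: "\<And>f g. P f \<Longrightarrow> P g \<Longrightarrow> P (f + g)"
  shows "P f"
proof -
  have "P (\<Sum>m\<in>A. Poly_Mapping.single m (Poly_Mapping.lookup f m))" if "finite A" for A
    using that
  proof (induction A)
    case empty
    show ?case using single[of undefined 0] by simp
  next
    case (insert m A)
    then show ?case using single add by simp
  qed
  from this[of "Poly_Mapping.keys f"] show ?thesis by (simp add: poly_mapping_sum_singles)
qed

lemma lookup_map_key: "inj s \<Longrightarrow> Poly_Mapping.lookup (Poly_Mapping.map_key s m) = Poly_Mapping.lookup m \<circ> s"
  by (simp add: map_key.rep_eq)

lemma map_key_inverse:
  assumes "bij s"
  shows "Poly_Mapping.map_key s (Poly_Mapping.map_key (inv s) m) = m"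
    and "Poly_Mapping.map_key (inv s) (Poly_Mapping.map_key s n) = n"
  using assms
  by (auto intro!: poly_mapping_eqI simp: lookup_map_key bij_imp_bij_inv bij_is_inj
      bij_is_surj surj_f_inv_f)

lemma inj_map_key: "bij s \<Longrightarrow> inj (Poly_Mapping.map_key s :: ('a \<Rightarrow>\<^sub>0 'b::zero) \<Rightarrow> _)"
  by (rule inj_on_inverseI[where g = "Poly_Mapping.map_key (inv s)"]) (simp add: map_key_inverse)

lemma lookup_perm_poly:
  "bij s \<Longrightarrow> Poly_Mapping.lookup (perm_poly s f) m = Poly_Mapping.lookup f (Poly_Mapping.map_key s m)"
  by (simp add: perm_poly_def lookup_map_key inj_map_key)

lemma perm_poly_single:
  assumes "bij s"
  shows "perm_poly s (Poly_Mapping.single m c) = Poly_Mapping.single (Poly_Mapping.map_key (inv s) m) c"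
proof -
  have "m = Poly_Mapping.map_key s k \<longleftrightarrow> Poly_Mapping.map_key (inv s) m = k" for k
    using map_key_inverse[OF assms] by metis
  then show ?thesis
    by (intro poly_mapping_eqI) (simp add: assms lookup_perm_poly lookup_single)
qed

lemma perm_poly_add: "bij s \<Longrightarrow> perm_poly s (f + g) = perm_poly s f + perm_poly s g"
  by (intro poly_mapping_eqI) (simp add: lookup_perm_poly lookup_add)

lemma perm_poly_diff: "bij s \<Longrightarrow> perm_poly s (f - g) = perm_poly s f - perm_poly s g"
  by (intro poly_mapping_eqI) (simp add: lookup_perm_poly lookup_minus)

lemma perm_poly_0 [simp]: "bij s \<Longrightarrow> perm_poly s 0 = 0"
  by (intro poly_mapping_eqI) (simp add: lookup_perm_poly)

lemma perm_poly_1 [simp]: "bij s \<Longrightarrow> perm_poly s 1 = 1"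
  using perm_poly_single[of s 0 1] by (simp add: bij_imp_bij_inv bij_is_inj)

lemma perm_poly_mult:
  assumes "bij s"
  shows "perm_poly s (f * g) = perm_poly s f * perm_poly s g"
proof (induction f rule: poly_mapping_induct)
  case (single a c)
  show ?case
  proof (induction g rule: poly_mapping_induct)
    case (single b d)
    show ?case
      using assms by (simp add: mult_single perm_poly_single map_key_plus bij_imp_bij_inv bij_is_inj)
  next
    case (add f g)
    then show ?case using assms by (simp add: perm_poly_add algebra_simps)
  qed
next
  case (add f g)
  then show ?case using assms by (simp add: perm_poly_add algebra_simps)
qed

lemma perm_poly_compose:
  assumes "bij s" "bij t"
  shows "perm_poly s (perm_poly t f) = perm_poly (s \<circ> t) f"
proof (rule poly_mapping_eqI)
  fix m :: monom
  have "Poly_Mapping.map_key t (Poly_Mapping.map_key s m) = Poly_Mapping.map_key (s \<circ> t) m"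
    using assms by (intro poly_mapping_eqI) (simp add: lookup_map_key bij_is_inj inj_compose)
  then show "Poly_Mapping.lookup (perm_poly s (perm_poly t f)) m = Poly_Mapping.lookup (perm_poly (s \<circ> t) f) m"
    using assms by (simp add: lookup_perm_poly bij_comp)
qed

lemma perm_poly_id [simp]: "perm_poly id f = f"
  by (intro poly_mapping_eqI) (simp add: lookup_perm_poly map_key_id[unfolded id_def[symmetric]])

lemma perm_poly_inject: "bij s \<Longrightarrow> perm_poly s f = perm_poly s g \<longleftrightarrow> f = g"
  by (metis bij_imp_bij_inv bij_is_inj inv_o_cancel perm_poly_compose perm_poly_id)

lemma perm_poly_X [simp]:
  assumes "bij s" shows "perm_poly s (X i) = X (s i)"
proof -
  have "Poly_Mapping.map_key (inv s) (Poly_Mapping.single i (1::nat)) = Poly_Mapping.single (s i) 1"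
    using assms
    by (intro poly_mapping_eqI)
      (auto simp: lookup_map_key bij_imp_bij_inv bij_is_inj lookup_single when_def bij_inv_eq_iff
        inv_f_f bij_is_surj surj_f_inv_f)
  then show ?thesis using assms by (simp add: X_def perm_poly_single)
qed

lemma X_inject: "X i = X j \<longleftrightarrow> i = j"
proof
  assume "X i = X j"
  then have "Poly_Mapping.lookup (X j) (Poly_Mapping.single i 1) = 1"
    by (metis X_def lookup_single_eq)
  then have "Poly_Mapping.single j (1::nat) = Poly_Mapping.single i 1"
    unfolding X_def lookup_single when_def by (auto split: if_splits)
  then have "Poly_Mapping.lookup (Poly_Mapping.single j (1::nat)) i = 1"
    by simp
  then show "i = j"
    by (simp add: lookup_single when_def split: if_splits)
qed simp

lemma X_nonzero [simp]: "X i \<noteq> 0"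
  by (metis X_def lookup_single_eq lookup_zero zero_neq_one)

lemma x_pow_eq_prod_X: "x_pow \<alpha> = (\<Prod>j<length \<alpha>. X j ^ (\<alpha> ! j))"
proof -
  have X_power: "X j ^ e = Poly_Mapping.single (Poly_Mapping.single j e) 1" for j e
    by (induction e) (simp_all add: X_def mult_single single_add[symmetric])
  have "(\<Prod>j<n. X j ^ (\<alpha> ! j)) = Poly_Mapping.single (\<Sum>j<n. Poly_Mapping.single j (\<alpha> ! j)) 1" for n
    by (induction n) (simp_all add: X_power mult_single ac_simps)
  moreover have "(\<Sum>j<length \<alpha>. Poly_Mapping.single j (\<alpha> ! j)) = Poly_Mapping.nth \<alpha>"
    by (intro poly_mapping_eqI) (auto simp: lookup_sum lookup_single when_def nth_default_def)
  ultimately show ?thesis by (simp add: x_pow_def)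
qed

section \<open>The isobaric divided differences\<close>

abbreviation adj_swap :: "nat \<Rightarrow> mpoly \<Rightarrow> mpoly" where
  "adj_swap i \<equiv> perm_poly (Transposition.transpose i (Suc i))"

lemma adj_swap_simps:
  "adj_swap i (f + g) = adj_swap i f + adj_swap i g"
  "adj_swap i (f - g) = adj_swap i f - adj_swap i g"
  "adj_swap i (f * g) = adj_swap i f * adj_swap i g"
  "adj_swap i (X j) = X (Transposition.transpose i (Suc i) j)"
  "adj_swap i (adj_swap i f) = f"
  by (simp_all add: perm_poly_add perm_poly_diff perm_poly_mult perm_poly_compose)

text \<open>
  The polynomials \<open>f\<close> for which the divisibility holds form a ring, because
  \<open>f g - s(f g) = (f - s f) g + s f (g - s g)\<close>; it contains the constants and the variables.
\<close>

lemma X_diff_dvd: "X i - X (Suc i) dvd f - adj_swap i f"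
proof (induction f rule: poly_mapping_induct)
  case (single m c)
  let ?D = "\<lambda>f. X i - X (Suc i) dvd f - adj_swap i f"
  have mult: "?D (f * g)" if "?D f" "?D g" for f g
  proof -
    have "f * g - adj_swap i (f * g) = (f - adj_swap i f) * g + adj_swap i f * (g - adj_swap i g)"
      by (simp add: perm_poly_mult algebra_simps)
    with that show ?thesis by (simp add: dvd_add)
  qed
  have X: "?D (X j)" for j
    using minus_dvd_iff[of "X (Suc i) - X i" "X (Suc i) - X i"]
    by (cases "j = i"; cases "j = Suc i") (auto simp: Transposition.transpose_def)
  have mono: "?D (Poly_Mapping.single n 1)" for n
  proof (induction n rule: poly_mapping_induct)
    case (single j e)
    show ?case
    proof (induction e)
      case 0
      then show ?case by simp
    next
      case (Suc e)
      have "Poly_Mapping.single (Poly_Mapping.single j (Suc e)) (1::qt)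
          = X j * Poly_Mapping.single (Poly_Mapping.single j e) 1"
        by (simp add: X_def mult_single single_add[symmetric])
      with mult[OF X Suc] show ?case by simp
    qed
  next
    case (add a b)
    from mult[OF this] show ?case by (simp add: mult_single)
  qed
  have const: "?D (Poly_Mapping.single 0 c)"
    by (simp add: perm_poly_single bij_imp_bij_inv bij_is_inj)
  from mult[OF const mono[of m]] show ?case by (simp add: mult_single)
next
  case (add f g)
  have "f + g - adj_swap i (f + g) = (f - adj_swap i f) + (g - adj_swap i g)"
    by (simp add: perm_poly_add)
  with add show ?case by (metis dvd_add)
qed

lemma poly_of_ratfun_to_fract [simp]: "poly_of_ratfun (to_fract f) = f"
  by (simp add: poly_of_ratfun_def)

lemma xi_eqI:
  assumes "(X i - X (Suc i)) * h = X i * f - X (Suc i) * adj_swap i f"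
  shows "xi i f = h"
proof -
  have nz: "to_fract (X i - X (Suc i)) \<noteq> 0"
    by (simp add: X_inject del: to_fract_diff)
  show ?thesis
    unfolding xi_def assms[symmetric] to_fract_mult using nz by simp
qed

text \<open>
  The quotient that defines \<open>xi\<close> is exact because
  \<open>X i * f - X (Suc i) * s f = (X i - X (Suc i)) * f + X (Suc i) * (f - s f)\<close>.  Since polynomials
  form a domain, the resulting equation determines \<open>xi i f\<close>, and all identities between these
  operators are obtained from it by cancellation.
\<close>

lemma xi_char: "(X i - X (Suc i)) * xi i f = X i * f - X (Suc i) * adj_swap i f"
proof -
  obtain h where h: "f - adj_swap i f = (X i - X (Suc i)) * h" using X_diff_dvd[of i f] unfolding dvd_def by blast
  have "X i * f - X (Suc i) * adj_swap i f = (X i - X (Suc i)) * f + X (Suc i) * (f - adj_swap i f)"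
    by (simp add: algebra_simps)
  also have "\<dots> = (X i - X (Suc i)) * (f + X (Suc i) * h)" by (simp add: h algebra_simps)
  finally show ?thesis using xi_eqI by metis
qed

lemma xi_eq_iff: "xi i f = h \<longleftrightarrow> (X i - X (Suc i)) * h = X i * f - X (Suc i) * adj_swap i f"
  using xi_eqI xi_char by blast

lemma xi_add: "xi i (f + g) = xi i f + xi i g"
  using xi_char[of i f] xi_char[of i g] by (simp add: xi_eq_iff adj_swap_simps algebra_simps)

lemma xi_0 [simp]: "xi i 0 = 0"
  by (simp add: xi_eq_iff)

lemma xi_fixed_iff: "xi i f = f \<longleftrightarrow> adj_swap i f = f"
proof -
  have "xi i f = f \<longleftrightarrow> X (Suc i) * adj_swap i f = X (Suc i) * f"
    unfolding xi_eq_iff by (auto simp: algebra_simps)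
  then show ?thesis by simp
qed

lemma adj_swap_xi [simp]: "adj_swap i (xi i f) = xi i f"
proof -
  have "(X (Suc i) - X i) * adj_swap i (xi i f) = adj_swap i ((X i - X (Suc i)) * xi i f)"
    by (simp add: adj_swap_simps)
  also have "\<dots> = - ((X i - X (Suc i)) * xi i f)"
    unfolding xi_char by (simp add: adj_swap_simps)
  also have "\<dots> = (X (Suc i) - X i) * xi i f"
    by (simp add: algebra_simps)
  finally show ?thesis by (simp add: X_inject)
qed

lemma xi_idem [simp]: "xi i (xi i f) = xi i f"
  by (simp add: xi_fixed_iff)

lemma xi_mult_invariant: "adj_swap i u = u \<Longrightarrow> xi i (u * f) = u * xi i f"
  by (simp add: xi_eq_iff adj_swap_simps)
    (metis (no_types, opaque_lifting) mult.left_commute right_diff_distrib xi_char)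

text \<open>
  The two Leibniz rules below decide what \<open>xi i\<close> does to a monomial factor that contains exactly one
  of the two variables it exchanges: a factor \<open>X i\<close> produces two terms with non-negative
  coefficients, and a factor \<open>X (Suc i)\<close> in front of something symmetric is annihilated.
\<close>

lemma xi_mult_X: "xi i (X i * g) = X i * g + X (Suc i) * xi i g"
proof -
  have "(X i - X (Suc i)) * (X i * g + X (Suc i) * xi i g)
      = (X i - X (Suc i)) * (X i * g) + X (Suc i) * ((X i - X (Suc i)) * xi i g)"
    by (simp add: algebra_simps)
  also have "\<dots> = X i * (X i * g) - X (Suc i) * adj_swap i (X i * g)"
    unfolding xi_char by (simp add: adj_swap_simps algebra_simps)
  finally show ?thesis by (rule xi_eqI)
qed

lemma xi_mult_X_Suc: "xi i g = g \<Longrightarrow> xi i (X (Suc i) * g) = 0"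
  by (simp add: xi_eq_iff xi_fixed_iff adj_swap_simps algebra_simps)

lemma xi_commute:
  assumes "Suc i < j"
  shows "xi i (xi j f) = xi j (xi i f)"
proof -
  let ?A = "X i - X (Suc i)" and ?B = "X j - X (Suc j)"
  have sX: "adj_swap i (X j) = X j" "adj_swap i (X (Suc j)) = X (Suc j)"
    "adj_swap j (X i) = X i" "adj_swap j (X (Suc i)) = X (Suc i)"
    using assms by (auto simp: Transposition.transpose_def)
  have ss: "adj_swap i (adj_swap j f) = adj_swap j (adj_swap i f)"
  proof -
    have "Transposition.transpose i (Suc i) \<circ> Transposition.transpose j (Suc j)
      = Transposition.transpose j (Suc j) \<circ> Transposition.transpose i (Suc i)"
      using assms by (auto simp: fun_eq_iff Transposition.transpose_def)
    then show ?thesis by (simp add: perm_poly_compose)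
  qed
  have fact: "?B * xi i (xi j f) = xi i (?B * xi j f)" "?A * xi j (xi i f) = xi j (?A * xi i f)"
    using sX by (simp_all add: xi_mult_invariant adj_swap_simps)
  have "?A * (?B * xi i (xi j f)) = ?B * (?A * xi j (xi i f))"
    unfolding fact xi_char[of j f] xi_char[of i f]
    unfolding xi_char using sX ss by (simp add: adj_swap_simps algebra_simps)
  then have "(?A * ?B) * xi i (xi j f) = (?A * ?B) * xi j (xi i f)" by (simp only: ac_simps)
  then show ?thesis by (simp add: X_inject)
qed

lemma xi_braid: "xi i (xi (Suc i) (xi i f)) = xi (Suc i) (xi i (xi (Suc i) f))"
proof -
  define a b c where "a = X i" and "b = X (Suc i)" and "c = X (Suc (Suc i))"
  let ?s = "adj_swap i" and ?t = "adj_swap (Suc i)"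
  have sX: "?s a = b" "?s b = a" "?s c = c" "?t a = a" "?t b = c" "?t c = b"
    by (auto simp: a_def b_def c_def Transposition.transpose_def)
  have sts: "?s (?t (?s f)) = ?t (?s (?t f))"
  proof -
    have "Transposition.transpose i (Suc i) \<circ> (Transposition.transpose (Suc i) (Suc (Suc i)) \<circ> Transposition.transpose i (Suc i))
      = Transposition.transpose (Suc i) (Suc (Suc i)) \<circ> (Transposition.transpose i (Suc i) \<circ> Transposition.transpose (Suc i) (Suc (Suc i)))"
      by (auto simp: fun_eq_iff Transposition.transpose_def)
    then show ?thesis by (simp add: perm_poly_compose bij_comp)
  qed
  have cs: "(a - b) * xi i f = a * f - b * ?s f" for f
    unfolding a_def b_def by (rule xi_char)
  have ct: "(b - c) * xi (Suc i) f = b * f - c * ?t f" for f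
    unfolding c_def b_def by (rule xi_char)
  have cst: "(a - c) * ?s (xi (Suc i) f) = a * ?s f - c * ?s (?t f)" for f
    using arg_cong[OF ct[of f], of ?s] by (simp add: adj_swap_simps(1-3) sX)
  have cts: "(a - c) * ?t (xi i f) = a * ?t f - c * ?t (?s f)" for f
    using arg_cong[OF cs[of f], of ?t] by (simp add: adj_swap_simps(1-3) sX)
  have csts: "(b - c) * ?s (?t (xi i f)) = b * ?s (?t f) - c * ?s (?t (?s f))" for f
    using arg_cong[OF cts[of f], of ?s] by (simp add: adj_swap_simps(1-3) sX)
  have ctst: "(a - b) * ?t (?s (xi (Suc i) f)) = a * ?t (?s f) - b * ?t (?s (?t f))" for f
    using arg_cong[OF cst[of f], of ?t] by (simp add: adj_swap_simps(1-3) sX)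
  \<comment> \<open>Both sides, multiplied by the Vandermonde product, are the alternating sum of the six images
    of \<open>a\<^sup>2 * b * f\<close>.\<close>
  define E where "E = a * a * b * f - a * b * b * ?s f - a * a * c * ?t f
    + b * b * c * ?s (?t f) + a * c * c * ?t (?s f) - b * c * c * ?s (?t (?s f))"
  have L: "(b - c) * ((a - c) * ((a - b) * xi i (xi (Suc i) (xi i f)))) = E"
  proof -
    have "(b - c) * ((a - c) * ((a - b) * xi i (xi (Suc i) (xi i f))))
      = (a - c) * (a * ((b - c) * xi (Suc i) (xi i f)))
        - (b - c) * (b * ((a - c) * ?s (xi (Suc i) (xi i f))))"
      unfolding cs by (simp add: algebra_simps)
    also have "\<dots> = (a - c) * a * b * xi i f - a * c * ((a - c) * ?t (xi i f))
        - (b - c) * b * a * xi i f + b * c * ((b - c) * ?s (?t (xi i f)))"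
      unfolding ct cst by (simp add: algebra_simps)
    also have "\<dots> = a * b * ((a - b) * xi i f)
        - a * c * ((a - c) * ?t (xi i f)) + b * c * ((b - c) * ?s (?t (xi i f)))"
      by (simp add: algebra_simps)
    also have "\<dots> = E"
      unfolding cs cts csts E_def by (simp add: algebra_simps)
    finally show ?thesis .
  qed
  have R: "(a - b) * ((a - c) * ((b - c) * xi (Suc i) (xi i (xi (Suc i) f)))) = E"
  proof -
    have "(a - b) * ((a - c) * ((b - c) * xi (Suc i) (xi i (xi (Suc i) f))))
      = (a - c) * (b * ((a - b) * xi i (xi (Suc i) f)))
        - (a - b) * (c * ((a - c) * ?t (xi i (xi (Suc i) f))))"
      unfolding ct by (simp add: algebra_simps)
    also have "\<dots> = a * b * ((a - c) * xi (Suc i) f) - b * b * ((a - c) * ?s (xi (Suc i) f))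
        - c * a * ((a - b) * xi (Suc i) f) + c * c * ((a - b) * ?t (?s (xi (Suc i) f)))"
      unfolding cs cts by (simp add: algebra_simps)
    also have "\<dots> = a * a * ((b - c) * xi (Suc i) f)
        - b * b * ((a - c) * ?s (xi (Suc i) f)) + c * c * ((a - b) * ?t (?s (xi (Suc i) f)))"
      by (simp add: algebra_simps)
    also have "\<dots> = E"
      unfolding ct cst ctst E_def by (simp add: algebra_simps sts)
    finally show ?thesis .
  qed
  have "((a - b) * (a - c) * (b - c)) * xi i (xi (Suc i) (xi i f))
      = ((a - b) * (a - c) * (b - c)) * xi (Suc i) (xi i (xi (Suc i) f))"
    using L R by (simp only: ac_simps)
  then show ?thesis by (simp add: a_def b_def c_def X_inject)
qed

section \<open>Key polynomials\<close>

definition swap_at :: "nat \<Rightarrow> nat list \<Rightarrow> nat list" where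
  "swap_at i \<alpha> = \<alpha>[i := \<alpha> ! Suc i, Suc i := \<alpha> ! i]"

lemma length_swap_at [simp]: "length (swap_at i \<alpha>) = length \<alpha>"
  by (simp add: swap_at_def)

lemma nth_swap_at:
  "Suc i < length \<alpha> \<Longrightarrow> k < length \<alpha> \<Longrightarrow> swap_at i \<alpha> ! k = \<alpha> ! Transposition.transpose i (Suc i) k"
  by (auto simp: swap_at_def nth_list_update Transposition.transpose_def)

lemma nth_swap_at_simps:
  assumes "Suc i < length \<alpha>"
  shows "swap_at i \<alpha> ! i = \<alpha> ! Suc i" "swap_at i \<alpha> ! Suc i = \<alpha> ! i"
    "k \<noteq> i \<Longrightarrow> k \<noteq> Suc i \<Longrightarrow> swap_at i \<alpha> ! k = \<alpha> ! k"
  using assms by (auto simp: swap_at_def nth_list_update)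

lemma swap_at_involutory: "Suc i < length \<alpha> \<Longrightarrow> swap_at i (swap_at i \<alpha>) = \<alpha>"
  by (rule nth_equalityI) (auto simp: swap_at_def nth_list_update)

lemma swap_at_trivial: "Suc i < length \<alpha> \<Longrightarrow> \<alpha> ! i = \<alpha> ! Suc i \<Longrightarrow> swap_at i \<alpha> = \<alpha>"
  by (rule nth_equalityI) (auto simp: swap_at_def nth_list_update)

lemma swap_at_commute:
  "Suc i < j \<Longrightarrow> Suc j < length \<alpha> \<Longrightarrow> swap_at i (swap_at j \<alpha>) = swap_at j (swap_at i \<alpha>)"
  by (rule nth_equalityI) (auto simp: swap_at_def nth_list_update)

lemma swap_at_braid:
  "Suc (Suc i) < length \<alpha> \<Longrightarrow>
    swap_at i (swap_at (Suc i) (swap_at i \<alpha>)) = swap_at (Suc i) (swap_at i (swap_at (Suc i) \<alpha>))"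
  by (rule nth_equalityI) (auto simp: swap_at_def nth_list_update)

lemma sum_list_swap_at:
  assumes "Suc i < length \<alpha>" shows "sum_list (swap_at i \<alpha>) = sum_list \<alpha>"
proof -
  have "mset (swap_at i \<alpha>) = mset \<alpha>"
    using assms by (simp add: swap_at_def mset_swap)
  then show ?thesis by (metis sum_mset_sum_list)
qed

text \<open>
  Exchanging the entries at an ascent lowers this number, so it measures how far a composition is
  from being dominant and serves for the inductions below.
\<close>

definition ascent_weight :: "nat list \<Rightarrow> nat" where
  "ascent_weight \<alpha> = (\<Sum>j<length \<alpha>. j * \<alpha> ! j)"

lemma ascent_weight_swap_at:
  assumes "Suc i < length \<alpha>" "\<alpha> ! i < \<alpha> ! Suc i"
  shows "ascent_weight (swap_at i \<alpha>) < ascent_weight \<alpha>"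
proof -
  let ?R = "{..<length \<alpha>} - {i, Suc i}"
  have split: "(\<Sum>j<length \<alpha>. f j) = f i + f (Suc i) + (\<Sum>j\<in>?R. f j)" for f :: "nat \<Rightarrow> nat"
  proof -
    have "{..<length \<alpha>} = insert i (insert (Suc i) ?R)" using assms by auto
    then have "(\<Sum>j<length \<alpha>. f j) = (\<Sum>j\<in>insert i (insert (Suc i) ?R). f j)" by simp
    also have "\<dots> = f i + f (Suc i) + (\<Sum>j\<in>?R. f j)" by (subst sum.insert; simp)
    finally show ?thesis .
  qed
  have "(\<Sum>j\<in>?R. j * swap_at i \<alpha> ! j) = (\<Sum>j\<in>?R. j * \<alpha> ! j)"
    using assms by (intro sum.cong) (auto simp: nth_swap_at_simps)
  moreover have "i * \<alpha> ! Suc i + Suc i * \<alpha> ! i < i * \<alpha> ! i + Suc i * \<alpha> ! Suc i"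
    using assms by simp
  ultimately show ?thesis
    using assms by (simp add: ascent_weight_def split nth_swap_at_simps)
qed

lemma ascent_if_not_dominant:
  assumes "\<not> sorted_wrt (\<ge>) (\<alpha> :: nat list)"
  obtains i where "Suc i < length \<alpha>" "\<alpha> ! i < \<alpha> ! Suc i"
proof -
  have "transp ((\<ge>) :: nat \<Rightarrow> nat \<Rightarrow> bool)" by (auto intro: transpI)
  with assms that show ?thesis
    by (auto simp: sorted_wrt_iff_nth_Suc_transp not_le)
qed

lemma is_key_swap_at:
  assumes "Suc i < length \<alpha>" "\<alpha> ! i < \<alpha> ! Suc i" "is_key (swap_at i \<alpha>) f"
  shows "is_key \<alpha> (xi i f)"
proof -
  have "is_key (swap_at i (swap_at i \<alpha>)) (xi i f)"
    unfolding swap_at_def[of i "swap_at i \<alpha>"]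
    using assms by (intro is_key.swap) (auto simp: nth_swap_at_simps)
  then show ?thesis using assms(1) by (simp add: swap_at_involutory)
qed

lemma is_key_cases:
  assumes "is_key \<alpha> f"
  obtains "sorted_wrt (\<ge>) \<alpha>" "f = x_pow \<alpha>"
  | i g where "Suc i < length \<alpha>" "\<alpha> ! i < \<alpha> ! Suc i" "is_key (swap_at i \<alpha>) g" "f = xi i g"
  using assms
proof cases
  case dominant
  with that show ?thesis by blast
next
  case (swap \<gamma> g i)
  from swap(1) have \<alpha>: "\<alpha> = swap_at i \<gamma>" by (simp only: swap_at_def)
  show ?thesis
    by (rule that(2)[of i g]) (use swap(2-) in \<open>simp_all add: \<alpha> swap_at_involutory nth_swap_at_simps\<close>)
qed

lemma is_key_exists: "\<exists>f. is_key \<alpha> f"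
proof (induction "ascent_weight \<alpha>" arbitrary: \<alpha> rule: less_induct)
  case less
  show ?case
  proof (cases "sorted_wrt (\<ge>) \<alpha>")
    case True
    then show ?thesis by (blast intro: is_key.dominant)
  next
    case False
    then obtain i where i: "Suc i < length \<alpha>" "\<alpha> ! i < \<alpha> ! Suc i" by (rule ascent_if_not_dominant)
    then show ?thesis using less[OF ascent_weight_swap_at[OF i]] is_key_swap_at by blast
  qed
qed

text \<open>
  Two derivations that end with exchanges at different ascents \<open>i\<close> and \<open>j\<close> of \<open>\<alpha>\<close> can be continued
  downwards to a common composition: sort the entries \<open>i, i + 1, i + 2\<close> completely if \<open>j = i + 1\<close>,
  perform the other exchange otherwise.  By induction the derivations may be taken to pass through
  that composition, and there the braid relation, respectively commutation, makes them agree.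
\<close>

lemma is_key_unique: "is_key \<alpha> f \<Longrightarrow> is_key \<alpha> g \<Longrightarrow> f = g"
proof (induction "ascent_weight \<alpha>" arbitrary: \<alpha> f g rule: less_induct)
  case less
  have IH: "u = v" if "is_key (swap_at i \<alpha>) u" "is_key (swap_at i \<alpha>) v"
    "Suc i < length \<alpha>" "\<alpha> ! i < \<alpha> ! Suc i" for u v i
    using less(1) that ascent_weight_swap_at by blast
  have diamond: "xi i u = xi j v"
    if i: "Suc i < length \<alpha>" "\<alpha> ! i < \<alpha> ! Suc i" "is_key (swap_at i \<alpha>) u"
      and j: "Suc j < length \<alpha>" "\<alpha> ! j < \<alpha> ! Suc j" "is_key (swap_at j \<alpha>) v"
      and "i < j" for i j u v
  proof (cases "j = Suc i")
    case True
    \<comment> \<open>The common composition has the three entries from position \<open>i\<close> on in reversed order.\<close>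
    let ?b = "swap_at i \<alpha>" and ?c = "swap_at (Suc i) \<alpha>"
    obtain w where w: "is_key (swap_at i (swap_at (Suc i) ?b)) w" using is_key_exists by blast
    have "is_key ?b (xi (Suc i) (xi i w))"
      using i j w True by (intro is_key_swap_at) (auto simp: nth_swap_at_simps)
    then have u: "u = xi (Suc i) (xi i w)" using IH i by blast
    have "is_key ?c (xi i (xi (Suc i) w))"
      using i j w True by (intro is_key_swap_at) (auto simp: nth_swap_at_simps swap_at_braid)
    then have v: "v = xi i (xi (Suc i) w)" using IH j True by blast
    show ?thesis using u v True xi_braid by simp
  next
    case False
    with \<open>i < j\<close> have ij: "Suc i < j" by simp
    obtain w where w: "is_key (swap_at j (swap_at i \<alpha>)) w" using is_key_exists by blast
    have "is_key (swap_at i \<alpha>) (xi j w)"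
      using i j w ij by (intro is_key_swap_at) (auto simp: nth_swap_at_simps)
    then have u: "u = xi j w" using IH i by blast
    have "is_key (swap_at j \<alpha>) (xi i w)"
      using i j w ij
      by (intro is_key_swap_at) (auto simp: nth_swap_at_simps swap_at_commute[of i j])
    then have v: "v = xi i w" using IH j by blast
    show ?thesis using u v xi_commute[OF ij] by simp
  qed
  from less(2) show ?case
  proof (cases rule: is_key_cases)
    case 1
    note f = 1
    from less(3) show ?thesis
    proof (cases rule: is_key_cases)
      case 1
      with f show ?thesis by simp
    next
      case (2 i h)
      with f(1) have "\<alpha> ! Suc i \<le> \<alpha> ! i" by (auto simp: sorted_wrt_iff_nth_less)
      with 2 show ?thesis by simp
    qed
  next
    case (2 i u)
    note f = 2
    from less(3) show ?thesis
    proof (cases rule: is_key_cases)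
      case 1
      then have "\<alpha> ! Suc i \<le> \<alpha> ! i" using f(1) by (auto simp: sorted_wrt_iff_nth_less)
      with f show ?thesis by simp
    next
      case (2 j v)
      consider "i = j" | "i < j" | "j < i" by linarith
      then show ?thesis
        by cases (use f 2 IH diamond in metis)+
    qed
  qed
qed

lemma key_poly_eqI: "is_key \<alpha> f \<Longrightarrow> key_poly \<alpha> = f"
  unfolding key_poly_def using is_key_unique by blast

lemma is_key_key_poly: "is_key \<alpha> (key_poly \<alpha>)"
  using is_key_exists key_poly_eqI by metis

lemma key_poly_dominant: "sorted_wrt (\<ge>) \<alpha> \<Longrightarrow> key_poly \<alpha> = x_pow \<alpha>"
  by (intro key_poly_eqI is_key.dominant)

lemma key_poly_ascent:
  "Suc i < length \<alpha> \<Longrightarrow> \<alpha> ! i < \<alpha> ! Suc i \<Longrightarrow> key_poly \<alpha> = xi i (key_poly (swap_at i \<alpha>))"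
  by (intro key_poly_eqI is_key_swap_at is_key_key_poly)

lemma adj_swap_x_pow:
  assumes "Suc i < length \<alpha>"
  shows "adj_swap i (x_pow \<alpha>) = x_pow (swap_at i \<alpha>)"
proof -
  let ?s = "Transposition.transpose i (Suc i)"
  have hom: "adj_swap i (\<Prod>j\<in>A. g j) = (\<Prod>j\<in>A. adj_swap i (g j))" for g :: "nat \<Rightarrow> mpoly" and A
    by (induction A rule: infinite_finite_induct) (simp_all add: perm_poly_mult)
  have hom_power: "adj_swap i (g ^ e) = adj_swap i g ^ e" for g e
    by (induction e) (simp_all add: perm_poly_mult)
  have perm: "?s permutes {..<length \<alpha>}"
    using assms by (intro permutes_swap_id) auto
  have "adj_swap i (x_pow \<alpha>) = (\<Prod>j<length \<alpha>. X (?s j) ^ (\<alpha> ! j))"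
    by (simp add: x_pow_eq_prod_X hom hom_power)
  also have "\<dots> = (\<Prod>j<length \<alpha>. X j ^ (\<alpha> ! ?s j))"
    by (subst prod.permute[OF perm]) simp
  also have "\<dots> = x_pow (swap_at i \<alpha>)"
    using assms by (simp add: x_pow_eq_prod_X nth_swap_at)
  finally show ?thesis .
qed

text \<open>
  A key polynomial is symmetric in two adjacent variables whose exponents in the index are equal.
  The symmetry is visible for a dominant index.  Otherwise the last operator \<open>xi j\<close> of a
  derivation commutes with \<open>xi i\<close>, or else the last two operators are \<open>xi j\<close> and \<open>xi i\<close>, and the braid
  relation moves \<open>xi i\<close> past both of them, turning it into \<open>xi j\<close>, which acts on two equal entries of a
  lighter index.
\<close>

lemma xi_key_poly_equal:
  "Suc i < length \<alpha> \<Longrightarrow> \<alpha> ! i = \<alpha> ! Suc i \<Longrightarrow> xi i (key_poly \<alpha>) = key_poly \<alpha>"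
proof (induction "ascent_weight \<alpha>" arbitrary: \<alpha> i rule: less_induct)
  case less
  note i = less.prems
  show ?case
  proof (cases "sorted_wrt (\<ge>) \<alpha>")
    case True
    with i show ?thesis
      by (simp add: key_poly_dominant xi_fixed_iff adj_swap_x_pow swap_at_trivial)
  next
    case False
    then obtain j where j: "Suc j < length \<alpha>" "\<alpha> ! j < \<alpha> ! Suc j" by (rule ascent_if_not_dominant)
    let ?b = "swap_at j \<alpha>"
    have w: "ascent_weight ?b < ascent_weight \<alpha>" using j by (rule ascent_weight_swap_at)
    have key: "key_poly \<alpha> = xi j (key_poly ?b)" using j by (rule key_poly_ascent)
    consider "j = Suc i" | "i = Suc j" | "Suc i < j" | "Suc j < i" using i j by (cases i j rule: linorder_cases) force+
    then show ?thesis
    proof cases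
      case 1
      let ?c = "swap_at i ?b"
      have asc: "?b ! i < ?b ! Suc i" using 1 i j by (simp add: nth_swap_at_simps)
      have kb: "key_poly ?b = xi i (key_poly ?c)"
        using asc i by (intro key_poly_ascent) auto
      have "ascent_weight ?c < ascent_weight \<alpha>"
        using w asc i ascent_weight_swap_at[of i ?b] by simp
      then have "xi j (key_poly ?c) = key_poly ?c"
        using less.hyps[of ?c j] 1 i j by (simp add: nth_swap_at_simps)
      then show ?thesis unfolding key kb using 1 xi_braid[of i "key_poly ?c"] by simp
    next
      case 2
      let ?c = "swap_at i ?b"
      have asc: "?b ! i < ?b ! Suc i" using 2 i j by (simp add: nth_swap_at_simps)
      have kb: "key_poly ?b = xi i (key_poly ?c)"
        using asc i by (intro key_poly_ascent) auto
      have "ascent_weight ?c < ascent_weight \<alpha>"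
        using w asc i ascent_weight_swap_at[of i ?b] by simp
      then have "xi j (key_poly ?c) = key_poly ?c"
        using less.hyps[of ?c j] 2 i j by (simp add: nth_swap_at_simps)
      then show ?thesis unfolding key kb using 2 xi_braid[of j "key_poly ?c"] by simp
    next
      case 3
      then have "xi i (key_poly ?b) = key_poly ?b"
        using less.hyps[OF w, of i] i j by (simp add: nth_swap_at_simps)
      then show ?thesis unfolding key using xi_commute[OF 3] by metis
    next
      case 4
      then have "xi i (key_poly ?b) = key_poly ?b"
        using less.hyps[OF w, of i] i j by (simp add: nth_swap_at_simps)
      then show ?thesis unfolding key using xi_commute[OF 4] by metis
    qed
  qed
qed

lemma xi_key_poly_le:
  "Suc i < length \<alpha> \<Longrightarrow> \<alpha> ! i \<le> \<alpha> ! Suc i \<Longrightarrow> xi i (key_poly \<alpha>) = key_poly \<alpha>"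
  by (metis key_poly_ascent le_neq_implies_less xi_idem xi_key_poly_equal)

lemma xi_key_poly_ge:
  assumes "Suc i < length \<alpha>" "\<alpha> ! Suc i \<le> \<alpha> ! i"
  shows "xi i (key_poly \<alpha>) = key_poly (swap_at i \<alpha>)"
proof (cases "\<alpha> ! i = \<alpha> ! Suc i")
  case True
  with assms show ?thesis by (simp add: xi_key_poly_equal swap_at_trivial)
next
  case False
  with assms have "key_poly (swap_at i \<alpha>) = xi i (key_poly (swap_at i (swap_at i \<alpha>)))"
    by (intro key_poly_ascent) (auto simp: nth_swap_at_simps)
  with assms show ?thesis by (simp add: swap_at_involutory)
qed

section \<open>Key polynomials have non-negative integer coefficients\<close>

lemma lookup_X_mult: "Poly_Mapping.lookup (X i * f) (Poly_Mapping.single i 1 + m) = Poly_Mapping.lookup f m"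
proof (induction f rule: poly_mapping_induct)
  case (single n c)
  then show ?case by (simp add: X_def mult_single lookup_single)
next
  case (add f g)
  then show ?case by (simp add: distrib_left lookup_add)
qed

lemma lookup_X_mult_zero: "Poly_Mapping.lookup m i = 0 \<Longrightarrow> Poly_Mapping.lookup (X i * f) m = 0"
proof (induction f rule: poly_mapping_induct)
  case (single n c)
  then show ?case
    by (auto simp: X_def mult_single lookup_single when_def lookup_add)
next
  case (add f g)
  then show ?case by (simp add: distrib_left lookup_add)
qed

lemma monom_cases:
  fixes m :: monom
  obtains "Poly_Mapping.lookup m i = 0" | n where "m = Poly_Mapping.single i 1 + n"
proof (cases "Poly_Mapping.lookup m i = 0")
  case False
  then have "m = Poly_Mapping.single i 1 + (m - Poly_Mapping.single i 1)"
    by (intro poly_mapping_eqI) (auto simp: lookup_add lookup_minus lookup_single when_def)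
  with that show ?thesis by blast
qed (use that in blast)

definition nat_coeffs :: "mpoly \<Rightarrow> bool" where
  "nat_coeffs f \<longleftrightarrow> (\<forall>m. Poly_Mapping.lookup f m \<in> \<nat>)"

lemma nat_coeffs_add: "nat_coeffs f \<Longrightarrow> nat_coeffs g \<Longrightarrow> nat_coeffs (f + g)"
  by (simp add: nat_coeffs_def lookup_add)

lemma nat_coeffs_X_mult:
  assumes "nat_coeffs f" shows "nat_coeffs (X i * f)"
  unfolding nat_coeffs_def
proof
  fix m :: monom
  show "Poly_Mapping.lookup (X i * f) m \<in> \<nat>"
    by (cases rule: monom_cases[of m i])
      (use assms in \<open>auto simp: nat_coeffs_def lookup_X_mult[unfolded One_nat_def] lookup_X_mult_zero\<close>)
qed

lemma nat_coeffs_prod_X_mult: "nat_coeffs f \<Longrightarrow> nat_coeffs (prod X C * f)"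
  by (induction C rule: infinite_finite_induct) (simp_all add: nat_coeffs_X_mult mult.assoc)

lemma nat_coeffs_x_pow: "nat_coeffs (x_pow \<alpha>)"
  by (simp add: nat_coeffs_def x_pow_def lookup_single when_def)

text \<open>
  Sums of products of a square-free monomial, with variables indexed by \<open>C\<close>, and a key polynomial of
  smaller degree.  One should think of \<open>C\<close> as the first column of a filling and of the key polynomial
  as the generating function of the remaining columns.  What makes the set stable under the operators
  \<open>xi i\<close> is the condition that the entries of \<open>\<beta>\<close> at positions in \<open>C\<close> are at least those at the
  other positions: it makes \<open>key_poly \<beta>\<close> symmetric in \<open>X i\<close> and \<open>X (Suc i)\<close> whenever \<open>C\<close>
  contains \<open>Suc i\<close> but not \<open>i\<close>.
\<close>

inductive_set strip_cone :: "nat \<Rightarrow> nat \<Rightarrow> mpoly set" for n d where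
  zero: "0 \<in> strip_cone n d"
| add: "\<lbrakk>length \<beta> = n; sum_list \<beta> < d; C \<subseteq> {..<n};
      \<And>i j. i \<in> C \<Longrightarrow> j < n \<Longrightarrow> j \<notin> C \<Longrightarrow> \<beta> ! j \<le> \<beta> ! i; f \<in> strip_cone n d\<rbrakk>
    \<Longrightarrow> prod X C * key_poly \<beta> + f \<in> strip_cone n d"

text \<open>
  Only the positions \<open>i\<close> and \<open>Suc i\<close> of \<open>C\<close> matter.  If \<open>C\<close> contains both or neither, the monomial is
  invariant and \<open>xi i\<close> acts on the key polynomial alone.  If it contains \<open>i\<close> only, the first Leibniz
  rule gives the original term plus the one with \<open>C\<close> and \<open>\<beta>\<close> both exchanged.  If it contains \<open>Suc i\<close>
  only, the key polynomial is symmetric and the second Leibniz rule gives zero.  No term with a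
  negative sign ever appears.
\<close>

lemma xi_strip_cone:
  assumes "f \<in> strip_cone n d" "Suc i < n"
  shows "xi i f \<in> strip_cone n d"
  using assms
proof (induction rule: strip_cone.induct)
  case zero
  show ?case by (simp add: strip_cone.zero)
next
  case (add \<beta> C f)
  let ?s = "Transposition.transpose i (Suc i)"
  have fin: "finite C" using add.hyps(3) finite_subset by blast
  have i: "Suc i < length \<beta>" using add by simp
  have IH: "xi i f \<in> strip_cone n d" using add by blast
  have same: "prod X C * key_poly \<beta> + g \<in> strip_cone n d" if "g \<in> strip_cone n d" for g
    using add.hyps that by (intro strip_cone.add) auto
  have swapped: "prod X (?s ` C) * key_poly (swap_at i \<beta>) + g \<in> strip_cone n d"
    if "g \<in> strip_cone n d" for g
  proof (rule strip_cone.add)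
    show "?s ` C \<subseteq> {..<n}"
      using add.hyps(3) add.prems by (auto simp: Transposition.transpose_def)
    show "swap_at i \<beta> ! j \<le> swap_at i \<beta> ! k" if "k \<in> ?s ` C" "j < n" "j \<notin> ?s ` C" for k j
    proof -
      have "?s k \<in> C" using that(1) by auto
      moreover have "?s j \<notin> C" using that(3) by (metis image_eqI transpose_involutory)
      moreover have "?s j < n" using that(2) add.prems by (auto simp: Transposition.transpose_def)
      moreover have "k < n" using \<open>?s ` C \<subseteq> {..<n}\<close> that(1) by auto
      ultimately show ?thesis
        using add.hyps(1,4) i that(2) by (simp add: nth_swap_at)
    qed
  qed (use add.hyps i that in \<open>auto simp: sum_list_swap_at\<close>)
  consider (both) "i \<in> C \<longleftrightarrow> Suc i \<in> C" | (lower) "i \<in> C" "Suc i \<notin> C" | (upper) "i \<notin> C" "Suc i \<in> C"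
    by blast
  then show ?case
  proof cases
    case both
    then have C: "?s ` C = C"
      by (auto simp: Transposition.transpose_def image_iff split: if_splits)
    have "adj_swap i (prod X C) = prod X C"
    proof -
      have "adj_swap i (prod X C) = prod X (?s ` C)"
      proof -
        have "adj_swap i (prod X A) = (\<Prod>j\<in>A. X (?s j))" if "finite A" for A
          using that by induction (simp_all add: perm_poly_mult)
        moreover have "inj_on ?s C" by (intro inj_onI) (metis transpose_involutory)
        ultimately show ?thesis
          using fin by (simp add: prod.reindex o_def)
      qed
      with C show ?thesis by simp
    qed
    then have "xi i (prod X C * key_poly \<beta> + f) = prod X C * xi i (key_poly \<beta>) + xi i f"
      by (simp add: xi_add xi_mult_invariant)
    then show ?thesis
      using same[OF IH] swapped[OF IH] i C
      by (cases "\<beta> ! i \<le> \<beta> ! Suc i") (simp_all add: xi_key_poly_le xi_key_poly_ge)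
  next
    case lower
    define u where "u = prod X (C - {i})"
    have ge: "\<beta> ! Suc i \<le> \<beta> ! i" using add lower by simp
    have inv: "adj_swap i u = u"
    proof -
      have "adj_swap i (prod X A) = prod X A" if "finite A" "i \<notin> A" "Suc i \<notin> A" for A
        using that by induction (auto simp: perm_poly_mult Transposition.transpose_def)
      then show ?thesis using fin lower by (simp add: u_def)
    qed
    have "?s ` C = insert (Suc i) (C - {i})"
      using lower by (auto simp: Transposition.transpose_def image_iff split: if_splits)
    then have C: "prod X C = u * X i" "prod X (?s ` C) = u * X (Suc i)"
      using fin lower by (simp_all add: u_def prod.remove[of C i] mult.commute)
    have "xi i (prod X C * key_poly \<beta> + f)
        = prod X C * key_poly \<beta> + (prod X (?s ` C) * key_poly (swap_at i \<beta>) + xi i f)"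
      unfolding C xi_add
      using inv ge i by (simp add: mult.assoc xi_mult_invariant xi_mult_X xi_key_poly_ge algebra_simps)
    then show ?thesis using same swapped IH by simp
  next
    case upper
    define u where "u = prod X (C - {Suc i})"
    have le: "\<beta> ! i \<le> \<beta> ! Suc i" using add upper by simp
    have inv: "adj_swap i u = u"
    proof -
      have "adj_swap i (prod X A) = prod X A" if "finite A" "i \<notin> A" "Suc i \<notin> A" for A
        using that by induction (auto simp: perm_poly_mult Transposition.transpose_def)
      then show ?thesis using fin upper by (simp add: u_def)
    qed
    have C: "prod X C = u * X (Suc i)"
      using fin upper by (simp add: u_def prod.remove[of C "Suc i"] mult.commute)
    have "xi i (prod X C * key_poly \<beta>) = 0"
      unfolding C using inv le i
      by (simp add: mult.assoc xi_mult_invariant xi_mult_X_Suc xi_key_poly_le)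
    then show ?thesis using IH by (simp add: xi_add)
  qed
qed

text \<open>
  For a dominant \<open>\<alpha>\<close> the monomial \<open>x_pow \<alpha>\<close> is the product of the variables that occur in it and of
  \<open>x_pow \<beta>\<close>, where \<open>\<beta>\<close> lowers every positive entry by one; the other key polynomials arise from
  dominant ones by the operators \<open>xi i\<close>.
\<close>

lemma key_poly_in_strip_cone:
  assumes "sum_list \<alpha> > 0"
  shows "key_poly \<alpha> \<in> strip_cone (length \<alpha>) (sum_list \<alpha>)"
  using assms
proof (induction "ascent_weight \<alpha>" arbitrary: \<alpha> rule: less_induct)
  case less
  show ?case
  proof (cases "sorted_wrt (\<ge>) \<alpha>")
    case True
    let ?n = "length \<alpha>"
    define C where "C = {j. j < ?n \<and> \<alpha> ! j > 0}"
    define \<beta> where "\<beta> = map (\<lambda>a. a - 1) \<alpha>"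
    have "sorted_wrt (\<ge>) \<beta>"
      unfolding \<beta>_def sorted_wrt_map by (rule sorted_wrt_mono_rel[OF _ True]) auto
    then have key: "key_poly \<beta> = x_pow \<beta>" by (rule key_poly_dominant)
    have "prod X C = (\<Prod>j<?n. if \<alpha> ! j > 0 then X j else 1)"
      unfolding C_def by (subst prod.inter_filter[symmetric]) (auto intro: prod.cong)
    then have "prod X C * key_poly \<beta> = (\<Prod>j<?n. (if \<alpha> ! j > 0 then X j else 1) * X j ^ (\<alpha> ! j - 1))"
      by (simp only: key x_pow_eq_prod_X prod.distrib) (simp add: \<beta>_def)
    also have "\<dots> = x_pow \<alpha>"
      unfolding x_pow_eq_prod_X by (intro prod.cong) (auto simp: power_eq_if)
    finally have eq: "key_poly \<alpha> = prod X C * key_poly \<beta> + 0"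
      using True by (simp add: key_poly_dominant)
    have le: "sum_list (map (\<lambda>a. a - 1) xs) \<le> sum_list xs" for xs :: "nat list"
      by (induction xs) auto
    have "sum_list (map (\<lambda>a. a - 1) xs) < sum_list xs" if "sum_list xs > 0" for xs :: "nat list"
      using that
    proof (induction xs)
      case (Cons a xs)
      then show ?case using le[of xs] by (cases "a = 0") auto
    qed simp
    then have "sum_list \<beta> < sum_list \<alpha>" using less.prems by (simp add: \<beta>_def)
    then show ?thesis
      unfolding eq by (intro strip_cone.add strip_cone.zero) (auto simp: \<beta>_def C_def)
  next
    case False
    then obtain i where i: "Suc i < length \<alpha>" "\<alpha> ! i < \<alpha> ! Suc i" by (rule ascent_if_not_dominant)
    have "key_poly (swap_at i \<alpha>) \<in> strip_cone (length \<alpha>) (sum_list \<alpha>)"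
      using less.hyps[OF ascent_weight_swap_at[OF i]] less.prems i by (simp add: sum_list_swap_at)
    then show ?thesis using i by (simp add: key_poly_ascent[of i] xi_strip_cone)
  qed
qed

lemma nat_coeffs_key_poly: "nat_coeffs (key_poly \<alpha>)"
proof (induction "sum_list \<alpha>" arbitrary: \<alpha> rule: less_induct)
  case less
  show ?case
  proof (cases "sum_list \<alpha> = 0")
    case True
    then have "\<alpha> ! j = 0" if "j < length \<alpha>" for j using that by simp
    then have "sorted_wrt (\<ge>) \<alpha>" by (simp add: sorted_wrt_iff_nth_less)
    then show ?thesis by (simp add: key_poly_dominant nat_coeffs_x_pow)
  next
    case False
    have "nat_coeffs f" if "f \<in> strip_cone (length \<alpha>) (sum_list \<alpha>)" for f
      using that
    proof induction
      case zero
      show ?case by (simp add: nat_coeffs_def)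
    next
      case (add \<beta> C f)
      then show ?case by (intro nat_coeffs_add nat_coeffs_prod_X_mult less)
    qed
    moreover have "sum_list \<alpha> > 0" using False by linarith
    ultimately show ?thesis using key_poly_in_strip_cone by blast
  qed
qed

section \<open>The symmetrizing operators as products of divided differences\<close>

subsection \<open>Permuting variables in rational functions\<close>

text \<open>
  The description in the definition does not depend on the chosen fraction because permuting variables
  is an injective ring homomorphism.
\<close>

lemma perm_ratfun_Fract:
  assumes "bij s" "b \<noteq> 0"
  shows "perm_ratfun s (Fract a b) = Fract (perm_poly s a) (perm_poly s b)"
proof -
  have nz: "perm_poly s b \<noteq> 0" if "b \<noteq> 0" for b
    using that perm_poly_inject[OF assms(1), of b 0] assms(1) by simp
  show ?thesis
    unfolding perm_ratfun_def
  proof (rule the_equality)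
    fix r assume "\<exists>a' b'. b' \<noteq> 0 \<and> Fract a b = Fract a' b' \<and> r = Fract (perm_poly s a') (perm_poly s b')"
    then obtain a' b' where ab: "b' \<noteq> 0" "Fract a b = Fract a' b'"
      and r: "r = Fract (perm_poly s a') (perm_poly s b')" by blast
    from ab assms(2) have "a * b' = a' * b" by (simp add: eq_fract)
    then have "perm_poly s a * perm_poly s b' = perm_poly s a' * perm_poly s b"
      by (metis assms(1) perm_poly_mult)
    then show "r = Fract (perm_poly s a) (perm_poly s b)"
      using nz ab(1) assms(2) r by (simp add: eq_fract)
  qed (use assms in blast)
qed

lemma perm_ratfun_to_fract: "bij s \<Longrightarrow> perm_ratfun s (to_fract f) = to_fract (perm_poly s f)"
  by (simp add: to_fract_def perm_ratfun_Fract)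

lemma perm_poly_nonzero: "bij s \<Longrightarrow> perm_poly s b \<noteq> 0 \<longleftrightarrow> b \<noteq> 0"
  using perm_poly_inject[of s b 0] by simp

lemma perm_ratfun_add:
  assumes "bij s" shows "perm_ratfun s (x + y) = perm_ratfun s x + perm_ratfun s y"
  by (cases x; cases y)
    (simp add: assms perm_ratfun_Fract perm_poly_add perm_poly_mult perm_poly_nonzero)

lemma perm_ratfun_mult:
  assumes "bij s" shows "perm_ratfun s (x * y) = perm_ratfun s x * perm_ratfun s y"
  by (cases x; cases y)
    (simp add: assms perm_ratfun_Fract perm_poly_mult perm_poly_nonzero)

lemma perm_ratfun_0 [simp]: "bij s \<Longrightarrow> perm_ratfun s 0 = 0"
  using perm_ratfun_to_fract[of s 0] by simp

lemma perm_ratfun_1 [simp]: "bij s \<Longrightarrow> perm_ratfun s 1 = 1"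
  using perm_ratfun_to_fract[of s 1] by simp

lemma perm_ratfun_compose:
  assumes "bij s" "bij t"
  shows "perm_ratfun s (perm_ratfun t x) = perm_ratfun (s \<circ> t) x"
  by (cases x)
    (simp add: assms perm_ratfun_Fract perm_poly_compose perm_poly_nonzero bij_comp)

lemma perm_ratfun_diff:
  assumes "bij s" shows "perm_ratfun s (x - y) = perm_ratfun s x - perm_ratfun s y"
  using perm_ratfun_add[OF assms, of "x - y" y] by (simp add: algebra_simps)

lemma perm_ratfun_divide:
  assumes "bij s" shows "perm_ratfun s (x / y) = perm_ratfun s x / perm_ratfun s y"
proof (cases "y = 0")
  case False
  then have "perm_ratfun s (1 / y) * perm_ratfun s y = 1"
    using assms by (simp flip: perm_ratfun_mult)
  then have "perm_ratfun s y \<noteq> 0" by auto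
  moreover have "perm_ratfun s (x / y) * perm_ratfun s y = perm_ratfun s x"
    using False assms by (simp flip: perm_ratfun_mult)
  ultimately show ?thesis by (simp add: field_simps)
qed (simp add: assms)

lemma perm_ratfun_prod:
  "bij s \<Longrightarrow> perm_ratfun s (\<Prod>i\<in>A. g i) = (\<Prod>i\<in>A. perm_ratfun s (g i))"
  by (induction A rule: infinite_finite_induct) (simp_all add: perm_ratfun_mult)

lemma perm_ratfun_sum:
  "bij s \<Longrightarrow> perm_ratfun s (\<Sum>i\<in>A. g i) = (\<Sum>i\<in>A. perm_ratfun s (g i))"
  by (induction A rule: infinite_finite_induct) (simp_all add: perm_ratfun_add)

abbreviation rX :: "nat \<Rightarrow> ratfun" where
  "rX i \<equiv> to_fract (X i)"

lemma perm_ratfun_rX: "bij s \<Longrightarrow> perm_ratfun s (rX i) = rX (s i)"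
  by (simp add: perm_ratfun_to_fract)

subsection \<open>The symmetrized sum\<close>

abbreviation pairs :: "nat \<Rightarrow> nat \<Rightarrow> (nat \<times> nat) set" where
  "pairs k n \<equiv> {(i, j). k \<le> i \<and> i < j \<and> j < n}"

lemma finite_pairs [simp]: "finite (pairs k n)"
  by (rule finite_subset[of _ "{..<n} \<times> {..<n}"]) auto

definition weyl_product :: "nat \<Rightarrow> nat \<Rightarrow> ratfun" where
  "weyl_product k n = (\<Prod>(i, j)\<in>pairs k n. 1 / (1 - rX j / rX i))"

definition symmetrized :: "nat \<Rightarrow> nat \<Rightarrow> ratfun \<Rightarrow> ratfun" where
  "symmetrized k n F = (\<Sum>\<sigma> | \<sigma> permutes {k..<n}. perm_ratfun \<sigma> (F * weyl_product k n))"

lemma weyl_factor: "p \<noteq> q \<Longrightarrow> p \<noteq> 0 \<Longrightarrow> 1 / (1 - q / p) = p / (p - q :: ratfun)"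
  by (simp add: divide_simps)

lemma W_fin_eq: "W_fin k n f = poly_of_ratfun (symmetrized k n (to_fract f))"
  by (simp add: W_fin_def symmetrized_def weyl_product_def)

text \<open>
  Write \<open>a = 1 / (1 - x\<^bsub>i+1\<^esub> / x\<^sub>i)\<close> and \<open>b = s a\<close> for the transposition \<open>s\<close> of \<open>i\<close> and \<open>i + 1\<close>, so that
  \<open>a + b = 1\<close> and \<open>xi i f = a * f + b * s f\<close>.  The product of all the factors but \<open>a\<close> is
  invariant under \<open>s\<close>, and replacing \<open>\<sigma>\<close> by \<open>\<sigma> \<circ> s\<close> in the sum turns the summand of
  \<open>b * s f * a\<close> into that of \<open>a * f * b\<close>.  Hence \<open>xi i f\<close> and \<open>(a + b) * f\<close> have the same image.
\<close>

lemma symmetrized_xi: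
  assumes "k \<le> i" "Suc i < n"
  shows "symmetrized k n (to_fract (xi i f)) = symmetrized k n (to_fract f)"
proof -
  let ?s = "Transposition.transpose i (Suc i)"
  let ?h = "\<lambda>(i, j). 1 / (1 - rX j / rX i)"
  define A where "A = pairs k n - {(i, Suc i)}"
  define P where "P = (\<Prod>p\<in>A. ?h p)"
  define a where "a = 1 / (1 - rX (Suc i) / rX i)"
  define b where "b = 1 / (1 - rX i / rX (Suc i))"
  let ?F = "to_fract f" and ?sF = "to_fract (adj_swap i f)"
  have weyl: "weyl_product k n = a * P"
    using assms prod.remove[of "pairs k n" "(i, Suc i)" ?h]
    by (simp add: weyl_product_def P_def A_def a_def)
  have nz: "rX i \<noteq> rX (Suc i)" "rX i \<noteq> 0" "rX (Suc i) \<noteq> 0"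
    by (simp_all add: X_inject)
  have ab_eq: "a = rX i / (rX i - rX (Suc i))" "b = - rX (Suc i) / (rX i - rX (Suc i))"
  proof -
    show "a = rX i / (rX i - rX (Suc i))"
      unfolding a_def using nz by (intro weyl_factor)
    have "b = rX (Suc i) / (rX (Suc i) - rX i)"
      unfolding b_def using nz by (intro weyl_factor) auto
    then show "b = - rX (Suc i) / (rX i - rX (Suc i))"
      by (metis minus_diff_eq minus_divide_left minus_divide_right)
  qed
  have "a + b = (rX i - rX (Suc i)) / (rX i - rX (Suc i))"
    unfolding ab_eq by (simp only: diff_divide_distrib minus_divide_left[symmetric]) simp
  then have ab: "a + b = 1" using nz by simp
  have sa: "perm_ratfun ?s a = b" "perm_ratfun ?s b = a"
    by (simp_all add: a_def b_def perm_ratfun_divide perm_ratfun_diff perm_ratfun_rX)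
  have sP: "perm_ratfun ?s P = P"
  proof -
    have bij: "bij_betw (map_prod ?s ?s) A A"
    proof (rule bij_betwI[where g = "map_prod ?s ?s"])
      show "map_prod ?s ?s \<in> A \<rightarrow> A"
        using assms by (auto simp: A_def Transposition.transpose_def split: if_splits)
      then show "map_prod ?s ?s \<in> A \<rightarrow> A" .
    qed auto
    have "perm_ratfun ?s P = (\<Prod>p\<in>A. ?h (map_prod ?s ?s p))"
      unfolding P_def
      by (subst perm_ratfun_prod)
        (auto intro!: prod.cong simp: perm_ratfun_divide perm_ratfun_diff perm_ratfun_rX)
    also have "\<dots> = P"
      unfolding P_def by (rule prod.reindex_bij_betw[OF bij])
    finally show ?thesis .
  qed
  have xi: "to_fract (xi i f) = a * ?F + b * ?sF"
  proof -
    have "(rX i - rX (Suc i)) * to_fract (xi i f) = rX i * ?F - rX (Suc i) * ?sF"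
      using arg_cong[OF xi_char[of i f], of to_fract] by simp
    then have "to_fract (xi i f) = (rX i * ?F - rX (Suc i) * ?sF) / (rX i - rX (Suc i))"
      using nz by (metis nonzero_mult_div_cancel_left right_minus_eq)
    then show ?thesis by (simp add: ab_eq diff_divide_distrib)
  qed
  have perm: "bij \<sigma>" if "\<sigma> permutes {k..<n}" for \<sigma> using that permutes_bij by blast
  have sum_s: "(\<Sum>\<sigma> | \<sigma> permutes {k..<n}. perm_ratfun \<sigma> (perm_ratfun ?s G))
      = (\<Sum>\<sigma> | \<sigma> permutes {k..<n}. perm_ratfun \<sigma> G)" for G
  proof -
    have "?s permutes {k..<n}" using assms by (intro permutes_swap_id) auto
    from sum_permutations_compose_right[OF this, of "\<lambda>\<sigma>. perm_ratfun \<sigma> G"]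
    show ?thesis by (simp add: perm_ratfun_compose perm)
  qed
  have "symmetrized k n (to_fract (xi i f))
    = (\<Sum>\<sigma> | \<sigma> permutes {k..<n}. perm_ratfun \<sigma> (a * ?F * (a * P)))
      + (\<Sum>\<sigma> | \<sigma> permutes {k..<n}. perm_ratfun \<sigma> (perm_ratfun ?s (b * ?F * (a * P))))"
    unfolding symmetrized_def xi weyl sum.distrib[symmetric]
    by (intro sum.cong)
      (auto simp: perm perm_ratfun_add[symmetric] perm_ratfun_mult[of ?s] sa sP perm_ratfun_to_fract
        algebra_simps)
  also have "\<dots> = (\<Sum>\<sigma> | \<sigma> permutes {k..<n}. perm_ratfun \<sigma> ((a + b) * ?F * (a * P)))"
    unfolding sum_s sum.distrib[symmetric]
    by (intro sum.cong) (auto simp: perm perm_ratfun_add[symmetric] algebra_simps)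
  also have "\<dots> = symmetrized k n ?F"
    by (simp add: ab symmetrized_def weyl)
  finally show ?thesis .
qed

text \<open>
  The value at \<open>0\<close> of the Lagrange interpolation of the constant \<open>1\<close> at the nodes \<open>y ` A\<close>.
\<close>

lemma lagrange_sum_eq_1:
  fixes y :: "'b \<Rightarrow> 'a::field"
  assumes "finite A" "A \<noteq> {}" "inj_on y A"
  shows "(\<Sum>b\<in>A. \<Prod>i\<in>A - {b}. y i / (y i - y b)) = 1"
proof -
  define L where "L b = (\<Prod>i\<in>A - {b}. [:y i / (y i - y b), - 1 / (y i - y b):])" for b
  have poly_L: "poly (L b) z = (\<Prod>i\<in>A - {b}. (y i - z) / (y i - y b))" for b z
    by (simp add: L_def poly_prod diff_divide_distrib)
  have deg: "degree (L b) < card A" if "b \<in> A" for b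
  proof -
    have "degree (L b) \<le> (\<Sum>i\<in>A - {b}. degree [:y i / (y i - y b), - 1 / (y i - y b):])"
      unfolding L_def using assms(1) by (intro degree_prod_sum_le[unfolded o_def]) auto
    also have "\<dots> \<le> (\<Sum>i\<in>A - {b}. 1)" by (intro sum_mono) simp
    also have "\<dots> = card (A - {b})" by simp
    also have "\<dots> < card A" using assms(1) that by (rule card_Diff1_less)
    finally show ?thesis .
  qed
  have "(\<Sum>b\<in>A. L b) = 1"
  proof (rule poly_eqI_degree[of "y ` A"])
    have card: "card (y ` A) = card A" "card A > 0"
      using assms by (auto simp: card_image card_gt_0_iff)
    show "degree (\<Sum>b\<in>A. L b) < card (y ` A)"
    proof -
      have "degree (\<Sum>b\<in>A. L b) \<le> card A - 1"
      proof (rule degree_sum_le[OF assms(1)])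
        show "degree (L b) \<le> card A - 1" if "b \<in> A" for b using deg[OF that] by linarith
      qed
      then show ?thesis using card by simp
    qed
    show "degree (1 :: 'a poly) < card (y ` A)" using card by simp
    fix z assume "z \<in> y ` A"
    then obtain c where c: "c \<in> A" "z = y c" by blast
    have "poly (L b) (y c) = (if b = c then 1 else 0)" if "b \<in> A" for b
    proof (cases "b = c")
      case True
      have "y i - y b \<noteq> 0" if "i \<in> A - {b}" for i
        using that \<open>b \<in> A\<close> assms(3) by (auto dest: inj_onD)
      then show ?thesis using True by (auto simp: poly_L intro!: prod.neutral)
    next
      case False
      then show ?thesis using c assms(1) by (auto simp: poly_L intro!: prod_zero)
    qed
    then show "poly (\<Sum>b\<in>A. L b) z = poly 1 z"
      using c assms(1) by (simp add: poly_sum)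
  qed
  then have "poly (\<Sum>b\<in>A. L b) 0 = 1" by simp
  then show ?thesis by (simp add: poly_sum poly_L)
qed

text \<open>
  Permutations of \<open>{k..<Suc n}\<close> are sorted by the position \<open>b\<close> to which they move \<open>n\<close>.  The factors
  that involve the index \<open>n\<close> are symmetric in the other variables, so the induction hypothesis
  evaluates the sum over each coset, and the sum over \<open>b\<close> that remains is a Lagrange interpolation.
\<close>

lemma symmetrized_1: "symmetrized k n 1 = 1"
proof (induction n)
  case 0
  then show ?case using perm_ratfun_1[of id] by (simp add: symmetrized_def weyl_product_def)
next
  case (Suc n)
  show ?case
  proof (cases "k \<le> n")
    case False
    then have "pairs k (Suc n) = {}" by auto
    then have "weyl_product k (Suc n) = 1" unfolding weyl_product_def by (simp only: prod.empty)
    then show ?thesis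
      using False perm_ratfun_1[of id] by (simp add: symmetrized_def)
  next
    case True
    let ?S = "{k..<n}" and ?t = "Transposition.transpose n"
    define R where "R = (\<Prod>i\<in>?S. 1 / (1 - rX n / rX i))"
    have perm: "bij \<sigma>" if "\<sigma> permutes ?S" for \<sigma> using that permutes_bij by blast
    have weyl: "weyl_product k (Suc n) = R * weyl_product k n"
    proof -
      have "pairs k (Suc n) = (\<lambda>i. (i, n)) ` ?S \<union> pairs k n"
        using True by (auto simp: less_Suc_eq)
      moreover have "(\<lambda>i. (i, n)) ` ?S \<inter> pairs k n = {}" by auto
      ultimately have "weyl_product k (Suc n) = (\<Prod>(i, j)\<in>(\<lambda>i. (i, n)) ` ?S. 1 / (1 - rX j / rX i)) * weyl_product k n"
        unfolding weyl_product_def by (simp only: prod.union_disjoint finite_pairs finite_imageI finite_atLeastLessThan)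
      also have "(\<Prod>(i, j)\<in>(\<lambda>i. (i, n)) ` ?S. 1 / (1 - rX j / rX i)) = R"
        unfolding R_def by (subst prod.reindex) (auto simp: inj_on_def)
      finally show ?thesis .
    qed
    have R: "perm_ratfun q R = R" if q: "q permutes ?S" for q
    proof -
      have "q n = n" using q by (auto simp: permutes_def)
      then have "perm_ratfun q R = (\<Prod>i\<in>?S. 1 / (1 - rX n / rX (q i)))"
        unfolding R_def using perm[OF q]
        by (simp add: perm_ratfun_prod perm_ratfun_divide perm_ratfun_diff perm_ratfun_rX)
      also have "\<dots> = R"
        unfolding R_def using prod.permute[OF q, of "\<lambda>i. 1 / (1 - rX n / rX i)"] by (simp add: o_def)
      finally show ?thesis .
    qed
    have inner: "(\<Sum>q | q permutes ?S. perm_ratfun (?t b \<circ> q) (R * weyl_product k n))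
        = (\<Prod>i\<in>insert n ?S - {b}. rX i / (rX i - rX b))" if b: "b \<in> insert n ?S" for b
    proof -
      have "(\<Sum>q | q permutes ?S. perm_ratfun (?t b \<circ> q) (R * weyl_product k n))
          = (\<Sum>q | q permutes ?S. perm_ratfun (?t b) (R * perm_ratfun q (weyl_product k n)))"
        by (intro sum.cong) (auto simp: perm R perm_ratfun_mult simp flip: perm_ratfun_compose)
      also have "\<dots> = perm_ratfun (?t b) (R * symmetrized k n 1)"
        by (simp add: symmetrized_def sum_distrib_left perm_ratfun_sum)
      also have "\<dots> = (\<Prod>i\<in>?S. 1 / (1 - rX b / rX (?t b i)))"
        unfolding Suc.IH R_def
        by (simp add: perm_ratfun_prod perm_ratfun_divide perm_ratfun_diff perm_ratfun_rX)
      also have "\<dots> = (\<Prod>i\<in>insert n ?S - {b}. 1 / (1 - rX b / rX i))"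
      proof (rule prod.reindex_bij_betw)
        show "bij_betw (?t b) ?S (insert n ?S - {b})"
          by (rule bij_betwI[where g = "?t b"]) (use b in \<open>auto simp: Transposition.transpose_def split: if_splits\<close>)
      qed
      also have "\<dots> = (\<Prod>i\<in>insert n ?S - {b}. rX i / (rX i - rX b))"
      proof (intro prod.cong refl)
        fix i assume "i \<in> insert n ?S - {b}"
        then show "1 / (1 - rX b / rX i) = rX i / (rX i - rX b)"
          by (intro weyl_factor) (auto simp: X_inject)
      qed
      finally show ?thesis .
    qed
    have "{k..<Suc n} = insert n ?S" using True by auto
    then have "symmetrized k (Suc n) 1
        = (\<Sum>b\<in>insert n ?S. \<Sum>q | q permutes ?S. perm_ratfun (?t b \<circ> q) (R * weyl_product k n))"
      unfolding symmetrized_def weyl by (simp add: sum_over_permutations_insert)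
    also have "\<dots> = (\<Sum>b\<in>insert n ?S. \<Prod>i\<in>insert n ?S - {b}. rX i / (rX i - rX b))"
      by (intro sum.cong refl inner)
    also have "\<dots> = 1"
      by (intro lagrange_sum_eq_1) (auto simp: inj_on_def X_inject)
    finally show ?thesis .
  qed
qed

lemma symmetrized_invariant:
  assumes "\<And>\<sigma>. \<sigma> permutes {k..<n} \<Longrightarrow> perm_poly \<sigma> h = h"
  shows "symmetrized k n (to_fract h) = to_fract h"
proof -
  have "symmetrized k n (to_fract h) = (\<Sum>\<sigma> | \<sigma> permutes {k..<n}. to_fract h * perm_ratfun \<sigma> (1 * weyl_product k n))"
    unfolding symmetrized_def
    by (intro sum.cong) (auto simp: assms perm_ratfun_mult perm_ratfun_to_fract permutes_bij)
  also have "\<dots> = to_fract h * symmetrized k n 1"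
    by (simp only: symmetrized_def sum_distrib_left)
  finally show ?thesis by (simp add: symmetrized_1)
qed

lemma perm_poly_invariant_if_adj_swap_invariant:
  assumes "\<sigma> permutes {k..<n}"
    and adj: "\<And>j. k \<le> j \<Longrightarrow> Suc j < n \<Longrightarrow> adj_swap j h = h"
  shows "perm_poly \<sigma> h = h"
proof -
  have less: "perm_poly (Transposition.transpose a b) h = h" if "k \<le> a" "a < b" "b < n" for a b
    using that(2,3)
  proof (induction b)
    case (Suc b)
    show ?case
    proof (cases "a = b")
      case True
      with adj Suc.prems that(1) show ?thesis by simp
    next
      case False
      let ?u = "Transposition.transpose b (Suc b)"
      have "Transposition.transpose a (Suc b) = ?u \<circ> (Transposition.transpose a b \<circ> ?u)"
        using False Suc.prems by (auto simp: fun_eq_iff Transposition.transpose_def)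
      moreover have "perm_poly (?u \<circ> (Transposition.transpose a b \<circ> ?u)) h = h"
        using False Suc that(1) adj[of b] by (simp add: bij_comp flip: perm_poly_compose)
      ultimately show ?thesis by (simp only:)
    qed
  qed simp
  have transp: "perm_poly (Transposition.transpose a b) h = h" if "a \<in> {k..<n}" "b \<in> {k..<n}" "a \<noteq> b" for a b
    using that less[of a b] less[of b a] by (cases "a < b") (auto simp: transpose_commute)
  show ?thesis
    using assms(1) finite_atLeastLessThan
  proof (induction \<sigma> rule: permutes_induct)
    case (swap a b p)
    have "perm_poly (Transposition.transpose a b \<circ> p) h = perm_poly (Transposition.transpose a b) (perm_poly p h)"
      using permutes_bij[OF swap.hyps(4)] by (intro perm_poly_compose[symmetric]) simp_all
    then show ?case
      using swap transp by (simp only:)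
  next
    case id
    show ?case by (rule perm_poly_id)
  qed
qed

subsection \<open>Symmetrization by divided differences\<close>

text \<open>
  \<open>cascade k d\<close> is \<open>xi k \<circ> xi (k + 1) \<circ> \<dots> \<circ> xi (k + d - 1)\<close>, and \<open>symmetrizer k d\<close> composes these along
  a reduced word of the longest permutation of the \<open>d\<close> variables from index \<open>k\<close> on.  With this choice
  of word the passage from \<open>d\<close> to \<open>d + 1\<close> variables happens on the left, which is what symmetry and
  the compatibility with setting the last variable to zero need.
\<close>

fun cascade :: "nat \<Rightarrow> nat \<Rightarrow> mpoly \<Rightarrow> mpoly" where
  "cascade k 0 f = f"
| "cascade k (Suc d) f = xi k (cascade (Suc k) d f)"

fun symmetrizer :: "nat \<Rightarrow> nat \<Rightarrow> mpoly \<Rightarrow> mpoly" where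
  "symmetrizer k 0 f = f"
| "symmetrizer k (Suc d) f = cascade k d (symmetrizer k d f)"

lemma xi_cascade_commute: "Suc i < k \<Longrightarrow> xi i (cascade k d f) = cascade k d (xi i f)"
  by (induction d arbitrary: k) (simp_all add: xi_commute)

lemma xi_cascade: "k < j \<Longrightarrow> j < k + d \<Longrightarrow> xi j (cascade k d f) = cascade k d (xi (j - 1) f)"
proof (induction d arbitrary: k)
  case (Suc d)
  show ?case
  proof (cases "j = Suc k")
    case True
    with Suc.prems obtain e where d: "d = Suc e" by (cases d) auto
    show ?thesis using True by (simp add: d xi_braid[symmetric] xi_cascade_commute)
  next
    case False
    then have "xi j (cascade (Suc k) d f) = cascade (Suc k) d (xi (j - 1) f)"
      using Suc by auto
    then show ?thesis using False Suc.prems xi_commute[of k j "cascade (Suc k) d f"] by simp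
  qed
qed simp

lemma xi_symmetrizer: "k \<le> j \<Longrightarrow> Suc j < k + d \<Longrightarrow> xi j (symmetrizer k d f) = symmetrizer k d f"
proof (induction d arbitrary: j)
  case (Suc d)
  show ?case
  proof (cases "j = k")
    case True
    with Suc.prems obtain e where "d = Suc e" by (cases d) auto
    then show ?thesis using True by simp
  next
    case False
    then show ?thesis using Suc by (simp add: xi_cascade)
  qed
qed simp

lemma symmetrized_cascade:
  "k \<le> a \<Longrightarrow> a + d < n \<Longrightarrow> symmetrized k n (to_fract (cascade a d f)) = symmetrized k n (to_fract f)"
  by (induction d arbitrary: a) (simp_all add: symmetrized_xi)

lemma symmetrized_symmetrizer:
  "k + d \<le> n \<Longrightarrow> symmetrized k n (to_fract (symmetrizer k d f)) = symmetrized k n (to_fract f)"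
  by (induction d) (simp_all add: symmetrized_cascade)

lemma perm_poly_symmetrizer:
  assumes "\<sigma> permutes {k..<k + d}"
  shows "perm_poly \<sigma> (symmetrizer k d f) = symmetrizer k d f"
  using assms
proof (rule perm_poly_invariant_if_adj_swap_invariant)
  show "adj_swap j (symmetrizer k d f) = symmetrizer k d f" if "k \<le> j" "Suc j < k + d" for j
    using xi_symmetrizer[OF that] by (simp add: xi_fixed_iff)
qed

text \<open>
  The symmetrized sum does not see the operators \<open>xi i\<close>, so \<open>f\<close> may be replaced by the polynomial
  \<open>symmetrizer k d f\<close>.  That one is symmetric and can be taken out of the sum, which leaves
  \<open>symmetrized k n 1 = 1\<close>.  In particular \<open>W_fin\<close> maps polynomials to polynomials.
\<close>

lemma W_fin_eq_symmetrizer: "W_fin k (k + d) f = symmetrizer k d f"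
proof -
  have "symmetrized k (k + d) (to_fract f) = symmetrized k (k + d) (to_fract (symmetrizer k d f))"
    by (simp add: symmetrized_symmetrizer)
  also have "\<dots> = to_fract (symmetrizer k d f)"
    by (intro symmetrized_invariant perm_poly_symmetrizer)
  finally show ?thesis by (simp add: W_fin_eq)
qed

lemma xi_preserves_key_polys:
  assumes "f \<in> key_poly ` {\<alpha>. length \<alpha> = n}" "Suc i < n"
  shows "xi i f \<in> key_poly ` {\<alpha>. length \<alpha> = n}"
proof -
  from assms(1) obtain \<alpha> where \<alpha>: "length \<alpha> = n" "f = key_poly \<alpha>" by blast
  show ?thesis
  proof (cases "\<alpha> ! i \<le> \<alpha> ! Suc i")
    case True
    with \<alpha> assms show ?thesis by (simp add: xi_key_poly_le)
  next
    case False
    with \<alpha> assms show ?thesis by (simp add: xi_key_poly_ge)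
  qed
qed

lemma cascade_preserves_key_polys:
  "f \<in> key_poly ` {\<alpha>. length \<alpha> = n} \<Longrightarrow> k + d < n \<or> d = 0 \<Longrightarrow> cascade k d f \<in> key_poly ` {\<alpha>. length \<alpha> = n}"
proof (induction d arbitrary: k)
  case (Suc d)
  then show ?case unfolding cascade.simps by (intro xi_preserves_key_polys) auto
qed simp

lemma symmetrizer_preserves_key_polys:
  "f \<in> key_poly ` {\<alpha>. length \<alpha> = n} \<Longrightarrow> k + d \<le> n \<Longrightarrow> symmetrizer k d f \<in> key_poly ` {\<alpha>. length \<alpha> = n}"
proof (induction d)
  case (Suc d)
  then show ?case unfolding symmetrizer.simps by (intro cascade_preserves_key_polys) auto
qed simp

section \<open>Setting variables to zero and bounding the degree\<close>

text \<open>
  Two instances are of interest: keeping the monomials in the first \<open>n\<close> variables, which sets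
  the others to zero, and keeping those of bounded total degree.  Both commute with the operators
  \<open>xi i\<close>, the former if \<open>Suc i < n\<close>, for a common reason.
\<close>

definition select :: "('a \<Rightarrow> bool) \<Rightarrow> ('a \<Rightarrow>\<^sub>0 'b::zero) \<Rightarrow> 'a \<Rightarrow>\<^sub>0 'b" where
  "select P f = Abs_poly_mapping (\<lambda>m. if P m then Poly_Mapping.lookup f m else 0)"

lemma lookup_select: "Poly_Mapping.lookup (select P f) m = (if P m then Poly_Mapping.lookup f m else 0)"
proof -
  have "{m. (if P m then Poly_Mapping.lookup f m else 0) \<noteq> 0} \<subseteq> Poly_Mapping.keys f"
    by (auto simp: in_keys_iff split: if_splits)
  then have "finite {m. (if P m then Poly_Mapping.lookup f m else 0) \<noteq> 0}"
    by (rule finite_subset) simp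
  then show ?thesis by (simp add: select_def)
qed

lemma keys_select: "Poly_Mapping.keys (select P f) = {m \<in> Poly_Mapping.keys f. P m}"
  by (auto simp: in_keys_iff lookup_select split: if_splits)

lemma select_diff:
  "select P (f - g :: 'a \<Rightarrow>\<^sub>0 'b::ab_group_add) = select P f - select P g"
  by (rule poly_mapping_eqI) (simp add: lookup_select lookup_minus)

lemma select_X_mult: "select P (X i * f) = X i * select (\<lambda>m. P (Poly_Mapping.single i 1 + m)) f"
proof (rule poly_mapping_eqI)
  fix m
  show "Poly_Mapping.lookup (select P (X i * f)) m
    = Poly_Mapping.lookup (X i * select (\<lambda>m. P (Poly_Mapping.single i 1 + m)) f) m"
    by (cases rule: monom_cases[of m i])
      (simp_all add: lookup_select lookup_X_mult[unfolded One_nat_def] lookup_X_mult_zero)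
qed

lemma select_perm_poly:
  assumes "bij s" "\<And>m. P (Poly_Mapping.map_key s m) = P m"
  shows "select P (perm_poly s f) = perm_poly s (select P f)"
  by (rule poly_mapping_eqI) (simp add: assms lookup_select lookup_perm_poly)

text \<open>
  Multiplication by \<open>X i\<close> or \<open>X (Suc i)\<close> may change the selected monomials from \<open>Q\<close> to \<open>P\<close>, for instance
  by raising a degree bound, as long as both variables do it in the same way.
\<close>

lemma select_xi:
  assumes "\<And>m. P (Poly_Mapping.single i 1 + m) = Q m" "\<And>m. P (Poly_Mapping.single (Suc i) 1 + m) = Q m"
    and "\<And>m. Q (Poly_Mapping.map_key (Transposition.transpose i (Suc i)) m) = Q m"
  shows "select Q (xi i f) = xi i (select Q f)"
proof -
  have "(X i - X (Suc i)) * select Q (xi i f) = select P ((X i - X (Suc i)) * xi i f)"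
    by (simp only: left_diff_distrib select_diff select_X_mult assms(1,2))
  also have "\<dots> = X i * select Q f - X (Suc i) * adj_swap i (select Q f)"
    using select_perm_poly[of "Transposition.transpose i (Suc i)" Q, OF _ assms(3)]
    by (simp only: xi_char select_diff select_X_mult assms(1,2) bij_transpose)
  finally show ?thesis by (rule xi_eqI[symmetric])
qed

abbreviation cut :: "nat \<Rightarrow> mpoly \<Rightarrow> mpoly" where
  "cut n \<equiv> select (\<lambda>m. Poly_Mapping.keys m \<subseteq> {..<n})"

lemma keys_single_add: "Poly_Mapping.keys (Poly_Mapping.single i 1 + m :: monom) = insert i (Poly_Mapping.keys m)"
  by (auto simp: in_keys_iff lookup_add lookup_single when_def split: if_splits)

lemma cut_xi:
  assumes "Suc i < n"
  shows "cut n (xi i f) = xi i (cut n f)"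
proof (rule select_xi[where P = "\<lambda>m. Poly_Mapping.keys m \<subseteq> {..<n}"])
  fix m :: monom
  let ?s = "Transposition.transpose i (Suc i)"
  have "inj ?s" by (simp add: bij_is_inj)
  moreover have "?s j < n \<longleftrightarrow> j < n" for j using assms by (auto simp: Transposition.transpose_def)
  ultimately show "Poly_Mapping.keys (Poly_Mapping.map_key ?s m) \<subseteq> {..<n} \<longleftrightarrow> Poly_Mapping.keys m \<subseteq> {..<n}"
    by (auto simp: keys_map_key subset_iff) (metis transpose_involutory)
qed (use assms in \<open>simp_all only: keys_single_add, auto\<close>)

text \<open>
  With \<open>X (Suc i)\<close> set to zero, the defining equation of \<open>xi i f\<close> becomes
  \<open>X i * xi i f = X i * f\<close>.
\<close>

lemma cut_xi_last: "cut (Suc i) (xi i f) = cut (Suc i) f"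
proof -
  have z: "cut (Suc i) (X (Suc i) * h) = 0" for h
    by (rule poly_mapping_eqI)
      (simp add: select_X_mult keys_single_add[unfolded One_nat_def] lookup_select, simp add: select_def)
  have p: "cut (Suc i) (X i * h) = X i * cut (Suc i) h" for h
    by (simp add: select_X_mult keys_single_add[unfolded One_nat_def])
  have "X i * cut (Suc i) (xi i f) = cut (Suc i) ((X i - X (Suc i)) * xi i f)"
    by (simp add: select_diff z p left_diff_distrib)
  also have "\<dots> = X i * cut (Suc i) f"
    unfolding xi_char by (simp add: select_diff z p)
  finally show ?thesis by simp
qed

lemma cut_cascade: "k + d < n \<Longrightarrow> cut n (cascade k d f) = cascade k d (cut n f)"
  by (induction d arbitrary: k) (simp_all add: cut_xi)

lemma cut_symmetrizer: "k + d \<le> n \<Longrightarrow> cut n (symmetrizer k d f) = symmetrizer k d (cut n f)"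
  by (induction d) (simp_all add: cut_cascade)

lemma cut_cascade_last: "cut (k + Suc d) (cascade k (Suc d) f) = cascade k d (cut (k + Suc d) f)"
proof (induction d arbitrary: k)
  case 0
  show ?case by (simp add: cut_xi_last)
next
  case (Suc d)
  from Suc[of "Suc k"] show ?case by (simp add: cut_xi)
qed

lemma cascade_fixed: "(\<And>j. k \<le> j \<Longrightarrow> j < k + d \<Longrightarrow> xi j f = f) \<Longrightarrow> cascade k d f = f"
  by (induction d arbitrary: k) simp_all

text \<open>
  Setting the last variable to zero removes the innermost operator of the leftmost cascade.  The
  other operators of this cascade then act on a polynomial that is already symmetric in the
  variables concerned, and so they do nothing.
\<close>

lemma cut_symmetrizer_Suc: "cut (k + d) (symmetrizer k (Suc d) f) = symmetrizer k d (cut (k + d) f)"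
proof (cases d)
  case (Suc e)
  have "cut (k + d) (symmetrizer k (Suc d) f) = cascade k e (symmetrizer k d (cut (k + d) f))"
    using cut_cascade_last[of k e] by (simp add: Suc cut_symmetrizer del: cascade.simps symmetrizer.simps(2) add: symmetrizer.simps(2)[of k "Suc e"])
  also have "\<dots> = symmetrizer k d (cut (k + d) f)"
    by (intro cascade_fixed xi_symmetrizer) (auto simp: Suc)
  finally show ?thesis .
qed simp

lemma total_degree_eq:
  assumes "finite A" "Poly_Mapping.keys m \<subseteq> A"
  shows "total_degree m = (\<Sum>i\<in>A. Poly_Mapping.lookup m i)"
  unfolding total_degree_def using assms by (intro sum.mono_neutral_left) (auto simp: in_keys_iff)

lemma total_degree_add: "total_degree (a + b) = total_degree a + total_degree b"
proof -
  let ?A = "Poly_Mapping.keys a \<union> Poly_Mapping.keys b"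
  have "Poly_Mapping.keys (a + b) \<subseteq> ?A" by (rule keys_add)
  then show ?thesis
    using total_degree_eq[of ?A "a + b"] total_degree_eq[of ?A a] total_degree_eq[of ?A b]
    by (simp add: lookup_add sum.distrib)
qed

lemma total_degree_map_key: "bij s \<Longrightarrow> total_degree (Poly_Mapping.map_key s m) = total_degree m"
proof -
  assume s: "bij s"
  have "bij_betw s (s -` Poly_Mapping.keys m) (Poly_Mapping.keys m)"
    using s by (auto simp: bij_betw_def inj_on_def surj_def image_iff dest: bij_is_inj bij_is_surj)
  from sum.reindex_bij_betw[OF this, of "Poly_Mapping.lookup m"] show ?thesis
    using s by (simp add: total_degree_def keys_map_key lookup_map_key bij_is_inj)
qed

abbreviation low_degree :: "nat \<Rightarrow> mpoly \<Rightarrow> mpoly" where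
  "low_degree d \<equiv> select (\<lambda>m. total_degree m \<le> d)"

lemma low_degree_xi: "low_degree d (xi i f) = xi i (low_degree d f)"
  by (rule select_xi[where P = "\<lambda>m. total_degree m \<le> Suc d"])
    (auto simp: total_degree_add total_degree_map_key, simp_all add: total_degree_def)

lemma low_degree_cascade: "low_degree d (cascade k e f) = cascade k e (low_degree d f)"
  by (induction e arbitrary: k) (simp_all add: low_degree_xi)

lemma low_degree_symmetrizer: "low_degree d (symmetrizer k e f) = symmetrizer k e (low_degree d f)"
  by (induction e) (simp_all add: low_degree_cascade)

section \<open>The limits of the symmetrizing operators\<close>

lemma finite_monoms_bounded:
  "finite {m :: monom. Poly_Mapping.keys m \<subseteq> {..<k} \<and> total_degree m \<le> d}" (is "finite ?A")
proof (rule finite_imageD)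
  let ?f = "\<lambda>m :: monom. map (Poly_Mapping.lookup m) [0..<k]"
  have "?f ` ?A \<subseteq> {xs. set xs \<subseteq> {..d} \<and> length xs = k}"
  proof safe
    fix m :: monom and i
    assume m: "total_degree m \<le> d"
    assume "i \<in> set (?f m)"
    then obtain j where j: "i = Poly_Mapping.lookup m j" by auto
    have "Poly_Mapping.lookup m j \<le> total_degree m"
    proof (cases "j \<in> Poly_Mapping.keys m")
      case True
      then show ?thesis unfolding total_degree_def by (intro member_le_sum) auto
    qed (simp add: in_keys_iff)
    with m j show "i \<le> d" by simp
  qed simp
  then show "finite (?f ` ?A)" by (rule finite_subset) (rule finite_lists_length_eq, simp)
  show "inj_on ?f ?A"
  proof (rule inj_onI, rule poly_mapping_eqI)
    fix m n :: monom and i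
    assume *: "m \<in> ?A" "n \<in> ?A" "?f m = ?f n"
    show "Poly_Mapping.lookup m i = Poly_Mapping.lookup n i"
    proof (cases "i < k")
      case True
      with *(3) show ?thesis by (auto simp: map_eq_conv)
    next
      case False
      with * have "i \<notin> Poly_Mapping.keys m" "i \<notin> Poly_Mapping.keys n" by auto
      then show ?thesis by (simp add: in_keys_iff)
    qed
  qed
qed

text \<open>
  Finiteness makes the sum that defines \<open>series_mult\<close> a genuine one: over an infinite set it would be
  zero by convention.
\<close>

lemma finite_add_decompositions: "finite {(a, b). a + b = (m :: monom)}"
proof (rule finite_subset)
  let ?A = "{a :: monom. Poly_Mapping.keys a \<subseteq> {..<Poly_Mapping.degree m} \<and> total_degree a \<le> total_degree m}"
  have "Poly_Mapping.keys a \<subseteq> Poly_Mapping.keys (a + b)" for a b :: monom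
    by (auto simp: in_keys_iff lookup_add)
  moreover have "Poly_Mapping.keys b \<subseteq> Poly_Mapping.keys (a + b)" for a b :: monom
    by (auto simp: in_keys_iff lookup_add)
  moreover have "Poly_Mapping.keys m \<subseteq> {..<Poly_Mapping.degree m}"
    using in_keys_less_degree by auto
  ultimately show "{(a, b). a + b = m} \<subseteq> ?A \<times> ?A"
    by (auto simp: total_degree_add) blast+
  show "finite (?A \<times> ?A)" by (intro finite_cartesian_product finite_monoms_bounded)
qed

lemma series_mult_single:
  "series_mult (Poly_Mapping.lookup (Poly_Mapping.single a 1)) h m
    = (if \<exists>b. m = a + b then h (m - a) else 0)"
proof (cases "\<exists>b. m = a + b")
  case True
  then obtain b where b: "m = a + b" by blast
  have "series_mult (Poly_Mapping.lookup (Poly_Mapping.single a 1)) h m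
      = (\<Sum>p\<in>{(a, b)}. case p of (u, v) \<Rightarrow> Poly_Mapping.lookup (Poly_Mapping.single a 1) u * h v)"
    unfolding series_mult_def
    by (rule sum.mono_neutral_right[OF finite_add_decompositions])
      (auto simp: b lookup_single when_def split: if_splits)
  then show ?thesis using True by (simp add: b)
next
  case False
  then show ?thesis
    unfolding series_mult_def by (auto intro!: sum.neutral simp: lookup_single when_def)
qed

definition bounded_degree :: "series \<Rightarrow> bool" where
  "bounded_degree f \<longleftrightarrow> (\<exists>d. \<forall>m. f m \<noteq> 0 \<longrightarrow> total_degree m \<le> d)"

lemma bounded_degree_lookup: "bounded_degree (Poly_Mapping.lookup f)"
  unfolding bounded_degree_def
proof (intro exI allI impI)
  fix m assume "Poly_Mapping.lookup f m \<noteq> 0"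
  then show "total_degree m \<le> Max (total_degree ` Poly_Mapping.keys f)"
    by (intro Max_ge) (auto simp: in_keys_iff)
qed

lemma bounded_degree_P_as:
  assumes "g \<in> P_as" shows "bounded_degree g"
proof -
  have mult: "bounded_degree (series_mult f h)" if f: "bounded_degree f" and h: "bounded_degree h" for f h
  proof -
    from f h obtain d e where d: "\<And>m. f m \<noteq> 0 \<Longrightarrow> total_degree m \<le> d"
      and e: "\<And>m. h m \<noteq> 0 \<Longrightarrow> total_degree m \<le> e"
      unfolding bounded_degree_def by blast
    have "total_degree m \<le> d + e" if "series_mult f h m \<noteq> 0" for m
    proof -
      from that obtain p where "p \<in> {(a, b). a + b = m}" "(case p of (a, b) \<Rightarrow> f a * h b) \<noteq> 0"
        unfolding series_mult_def using sum.not_neutral_contains_not_neutral by blast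
      then obtain a b where "m = a + b" "f a \<noteq> 0" "h b \<noteq> 0" by auto
      then show ?thesis using d e by (simp add: total_degree_add add_mono)
    qed
    then show ?thesis unfolding bounded_degree_def by blast
  qed
  have plus: "bounded_degree (\<lambda>m. f m + h m)" if f: "bounded_degree f" and h: "bounded_degree h" for f h
  proof -
    from f h obtain d e where d: "\<And>m. f m \<noteq> 0 \<Longrightarrow> total_degree m \<le> d"
      and e: "\<And>m. h m \<noteq> 0 \<Longrightarrow> total_degree m \<le> e"
      unfolding bounded_degree_def by blast
    have "total_degree m \<le> max d e" if "f m + h m \<noteq> 0" for m
    proof (cases "f m = 0")
      case True
      with that e[of m] show ?thesis by simp
    next
      case False
      with d[of m] show ?thesis by simp
    qed
    then show ?thesis unfolding bounded_degree_def by blast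
  qed
  from assms obtain k N p h where
    g: "g = (\<lambda>m. \<Sum>j<(N::nat). series_mult (Poly_Mapping.lookup (p j)) (h j) m)"
    and h: "\<And>j. j < N \<Longrightarrow> h j \<in> Lambda k"
    unfolding P_as_def P_k_def by blast
  have "bounded_degree (series_mult (Poly_Mapping.lookup (p j)) (h j))" if "j < N" for j
    using h[OF that] by (intro mult bounded_degree_lookup) (auto simp: Lambda_def bounded_degree_def)
  then have "bounded_degree (\<lambda>m. \<Sum>j<N. series_mult (Poly_Mapping.lookup (p j)) (h j) m)"
  proof (induction N)
    case 0
    show ?case by (simp add: bounded_degree_def)
  next
    case (Suc N)
    have "bounded_degree (\<lambda>m. \<Sum>j<N. series_mult (Poly_Mapping.lookup (p j)) (h j) m)"
      by (rule Suc.IH) (rule Suc.prems, simp)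
    moreover have "bounded_degree (series_mult (Poly_Mapping.lookup (p N)) (h N))"
      by (rule Suc.prems) simp
    ultimately show ?case unfolding sum.lessThan_Suc by (rule plus)
  qed
  then show ?thesis using g by simp
qed

lemma lookup_truncate:
  assumes "bounded_degree f"
  shows "Poly_Mapping.lookup (truncate n f) m = (if Poly_Mapping.keys m \<subseteq> {..<n} then f m else 0)"
proof -
  from assms obtain d where d: "\<And>m. f m \<noteq> 0 \<Longrightarrow> total_degree m \<le> d"
    unfolding bounded_degree_def by blast
  have "{m. (if Poly_Mapping.keys m \<subseteq> {..<n} then f m else 0) \<noteq> 0}
      \<subseteq> {m. Poly_Mapping.keys m \<subseteq> {..<n} \<and> total_degree m \<le> d}"
    using d by (auto split: if_splits)
  then have "finite {m. (if Poly_Mapping.keys m \<subseteq> {..<n} then f m else 0) \<noteq> 0}"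
    by (rule finite_subset) (rule finite_monoms_bounded)
  then show ?thesis unfolding truncate_def by simp
qed

text \<open>
  \<open>Poly_Mapping.degree m\<close> is not the total degree: it is one more than the largest index of a variable
  occurring in \<open>m\<close>, or \<open>0\<close>, hence a canonical number of variables that suffices for \<open>m\<close>.
\<close>

lemma keys_subset_degree: "Poly_Mapping.keys (m :: monom) \<subseteq> {..<k + Poly_Mapping.degree m}"
  using in_keys_less_degree by fastforce

text \<open>
  Sort the monomials of the series by their exponents in the first \<open>k\<close> variables.  There are finitely
  many such exponent vectors because the degree is bounded, and the coefficient of each is a
  symmetric function in the remaining variables.
\<close>

lemma P_k_if_symmetric:
  assumes deg: "bounded_degree g"
    and sym: "\<And>n \<sigma> m. \<sigma> permutes {k..<n} \<Longrightarrow> g (Poly_Mapping.map_key \<sigma> m) = g m"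
  shows "g \<in> P_k k"
proof -
  from deg obtain d where d: "\<And>m. g m \<noteq> 0 \<Longrightarrow> total_degree m \<le> d"
    unfolding bounded_degree_def by blast
  define A where "A = {a :: monom. Poly_Mapping.keys a \<subseteq> {..<k} \<and> total_degree a \<le> d}"
  have finA: "finite A" unfolding A_def by (rule finite_monoms_bounded)
  define h where "h a = (\<lambda>b. if Poly_Mapping.keys b \<subseteq> {k..} then g (a + b) else 0)" for a
  have h: "h a \<in> Lambda k" if "a \<in> A" for a
    unfolding Lambda_def
  proof (intro CollectI conjI allI impI exI)
    show "total_degree b \<le> d" if "h a b \<noteq> 0" for b
      using that d[of "a + b"] by (auto simp: h_def total_degree_add split: if_splits)
    show "Poly_Mapping.keys b \<subseteq> {k..}" if "h a b \<noteq> 0" for b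
      using that by (auto simp: h_def split: if_splits)
    fix n \<sigma> and b :: monom
    assume \<sigma>: "\<sigma> permutes {k..<n}"
    then have inj: "inj \<sigma>" and bij: "bij \<sigma>" by (simp_all add: permutes_inj permutes_bij)
    have ge: "\<sigma> i \<ge> k \<longleftrightarrow> i \<ge> k" for i
      using \<sigma> permutes_in_image[OF \<sigma>, of i] permutes_not_in[OF \<sigma>, of i] by (cases "i \<in> {k..<n}") auto
    have "Poly_Mapping.keys (Poly_Mapping.map_key \<sigma> b) \<subseteq> {k..} \<longleftrightarrow> Poly_Mapping.keys b \<subseteq> {k..}"
      using bij ge unfolding keys_map_key[OF inj] by (auto simp: subset_iff) (metis bij_pointE)
    moreover have "a = Poly_Mapping.map_key \<sigma> a"
    proof (rule poly_mapping_eqI)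
      fix i
      show "Poly_Mapping.lookup a i = Poly_Mapping.lookup (Poly_Mapping.map_key \<sigma> a) i"
      proof (cases "i < k")
        case True
        then have "\<sigma> i = i" using permutes_not_in[OF \<sigma>, of i] by simp
        then show ?thesis by (simp add: lookup_map_key[OF inj])
      next
        case False
        then have "i \<notin> Poly_Mapping.keys a" "\<sigma> i \<notin> Poly_Mapping.keys a"
          using that ge[of i] by (auto simp: A_def)
        then show ?thesis by (simp add: lookup_map_key[OF inj] in_keys_iff)
      qed
    qed
    then have "a + Poly_Mapping.map_key \<sigma> b = Poly_Mapping.map_key \<sigma> (a + b)"
      by (simp add: map_key_plus[OF inj])
    ultimately show "h a (Poly_Mapping.map_key \<sigma> b) = h a b"
      using sym[OF \<sigma>] by (simp add: h_def)
  qed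
  have sum: "g m = (\<Sum>a\<in>A. series_mult (Poly_Mapping.lookup (Poly_Mapping.single a 1)) (h a) m)" for m
  proof -
    define u where "u = select (\<lambda>i. i < k) m"
    define v where "v = select (\<lambda>i. \<not> i < k) m"
    have m: "m = u + v"
      by (rule poly_mapping_eqI) (simp add: u_def v_def lookup_add lookup_select)
    have u: "Poly_Mapping.keys u \<subseteq> {..<k}" and v: "Poly_Mapping.keys v \<subseteq> {k..}"
      by (auto simp: u_def v_def keys_select)
    have "series_mult (Poly_Mapping.lookup (Poly_Mapping.single a 1)) (h a) m = (if a = u then g m else 0)"
      if "a \<in> A" for a
    proof (cases "a = u")
      case True
      then show ?thesis using v by (simp add: series_mult_single m h_def)
    next
      case False
      have "\<not> Poly_Mapping.keys b \<subseteq> {k..}" if b: "m = a + b" for b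
      proof
        assume "Poly_Mapping.keys b \<subseteq> {k..}"
        then have "Poly_Mapping.lookup b i = 0" if "i < k" for i using that by (force simp: in_keys_iff)
        moreover have "Poly_Mapping.lookup a i = 0" if "\<not> i < k" for i
          using that \<open>a \<in> A\<close> by (force simp: A_def in_keys_iff)
        ultimately have "u = a"
          by (intro poly_mapping_eqI) (simp add: u_def lookup_select b lookup_add)
        with False show False by simp
      qed
      then show ?thesis using False by (auto simp: series_mult_single h_def)
    qed
    then have "(\<Sum>a\<in>A. series_mult (Poly_Mapping.lookup (Poly_Mapping.single a 1)) (h a) m)
        = (\<Sum>a\<in>A. if a = u then g m else 0)" by (rule sum.cong[OF refl])
    also have "\<dots> = (if u \<in> A then g m else 0)" using finA by (simp add: sum.delta)
    also have "\<dots> = g m"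
    proof (cases "u \<in> A")
      case False
      then have "\<not> total_degree m \<le> d" using u by (auto simp: A_def m total_degree_add)
      with d False show ?thesis by auto
    qed simp
    finally show ?thesis by simp
  qed
  obtain e where e: "bij_betw e {0..<card A} A"
    using ex_bij_betw_nat_finite[OF finA] by blast
  have "g = (\<lambda>m. \<Sum>j<card A. series_mult (Poly_Mapping.lookup (Poly_Mapping.single (e j) 1)) (h (e j)) m)"
  proof
    fix m
    show "g m = (\<Sum>j<card A. series_mult (Poly_Mapping.lookup (Poly_Mapping.single (e j) 1)) (h (e j)) m)"
      unfolding sum[of m] lessThan_atLeast0 by (rule sum.reindex_bij_betw[OF e, symmetric])
  qed
  moreover have "Poly_Mapping.single (e j) 1 \<in> polys k" "h (e j) \<in> Lambda k" if "j < card A" for j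
  proof -
    have "e j \<in> A" using e that by (auto simp: bij_betw_def)
    then show "Poly_Mapping.single (e j) 1 \<in> polys k" "h (e j) \<in> Lambda k"
      by (auto simp: polys_def A_def intro: h)
  qed
  ultimately show ?thesis
    unfolding P_k_def by (intro CollectI exI[of _ "card A"] exI[of _ "\<lambda>j. Poly_Mapping.single (e j) 1"]
        exI[of _ "\<lambda>j. h (e j)"]) simp
qed

text \<open>
  The polynomials \<open>W_fin k n (truncate n f)\<close> are compatible with setting the last variable to zero, so
  they are the truncations of one series.  It inherits the degree bound and the symmetry, hence
  lies in \<open>P_k k\<close>, and an almost symmetric function is determined by its truncations.
\<close>

lemma W_limit:
  assumes f: "bounded_degree f"
  shows "bounded_degree (W k f)"
    and "\<And>n. k \<le> n \<Longrightarrow> truncate n (W k f) = W_fin k n (truncate n f)"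
    and "\<And>n \<sigma> m. \<sigma> permutes {k..<n} \<Longrightarrow> W k f (Poly_Mapping.map_key \<sigma> m) = W k f m"
proof -
  define F where "F d = symmetrizer k d (truncate (k + d) f)" for d
  define g where "g m = Poly_Mapping.lookup (F (Poly_Mapping.degree m)) m" for m
  have F_cut: "cut (k + d) (F (Suc d)) = F d" for d
  proof -
    have "cut (k + d) (truncate (k + Suc d) f) = truncate (k + d) f"
      by (rule poly_mapping_eqI) (auto simp: lookup_select lookup_truncate[OF f])
    then show ?thesis unfolding F_def by (simp only: cut_symmetrizer_Suc)
  qed
  have F_stable: "Poly_Mapping.lookup (F (d + e)) m = Poly_Mapping.lookup (F d) m"
    if m: "Poly_Mapping.keys m \<subseteq> {..<k + d}" for d e m
  proof (induction e)
    case (Suc e)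
    have "Poly_Mapping.keys m \<subseteq> {..<k + (d + e)}" using m by auto
    with arg_cong[OF F_cut[of "d + e"], of "\<lambda>h. Poly_Mapping.lookup h m"] Suc show ?case
      by (simp add: lookup_select)
  qed simp
  have g_eq: "g m = Poly_Mapping.lookup (F d) m" if "Poly_Mapping.keys m \<subseteq> {..<k + d}" for m d
    using F_stable[OF that, of "Poly_Mapping.degree m"] F_stable[OF keys_subset_degree[of m k], of d]
    by (simp add: g_def add.commute)
  have F_polys: "Poly_Mapping.lookup (F d) m = 0" if "\<not> Poly_Mapping.keys m \<subseteq> {..<k + d}" for m d
  proof -
    have "cut (k + d) (truncate (k + d) f) = truncate (k + d) f"
      by (rule poly_mapping_eqI) (auto simp: lookup_select lookup_truncate[OF f])
    then have "cut (k + d) (F d) = F d" unfolding F_def by (simp add: cut_symmetrizer)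
    then show ?thesis using that by (metis lookup_select)
  qed
  have g_bounded: "bounded_degree g"
  proof -
    from f obtain c where c: "\<And>m. f m \<noteq> 0 \<Longrightarrow> total_degree m \<le> c"
      unfolding bounded_degree_def by blast
    have "low_degree c (truncate n f) = truncate n f" for n
      by (rule poly_mapping_eqI) (use c in \<open>auto simp: lookup_select lookup_truncate[OF f]\<close>)
    then have "low_degree c (F d) = F d" for d
      by (simp add: F_def low_degree_symmetrizer)
    then have "total_degree m \<le> c" if "g m \<noteq> 0" for m
      using that unfolding g_def by (metis lookup_select)
    then show ?thesis unfolding bounded_degree_def by blast
  qed
  have g_truncate: "truncate n g = W_fin k n (truncate n f)" if "k \<le> n" for n
  proof -
    from that obtain d where n: "n = k + d" using le_Suc_ex by blast
    show ?thesis
      unfolding n W_fin_eq_symmetrizer F_def[symmetric]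
      by (rule poly_mapping_eqI) (simp add: lookup_truncate[OF g_bounded] g_eq F_polys)
  qed
  have g_sym: "g (Poly_Mapping.map_key \<sigma> m) = g m" if \<sigma>: "\<sigma> permutes {k..<n}" for n \<sigma> m
  proof -
    define d where "d = n + Poly_Mapping.degree m + Poly_Mapping.degree (Poly_Mapping.map_key \<sigma> m)"
    have "\<sigma> permutes {k..<k + d}" using \<sigma> by (rule permutes_subset) (auto simp: d_def)
    then have inv: "perm_poly \<sigma> (F d) = F d" by (simp add: F_def perm_poly_symmetrizer)
    have "Poly_Mapping.keys m \<subseteq> {..<k + d}" "Poly_Mapping.keys (Poly_Mapping.map_key \<sigma> m) \<subseteq> {..<k + d}"
      using keys_subset_degree[of m k] keys_subset_degree[of "Poly_Mapping.map_key \<sigma> m" k]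
      by (auto simp: d_def)
    then show ?thesis
      using lookup_perm_poly[OF permutes_bij[OF \<sigma>], of "F d" m] by (simp add: g_eq inv)
  qed
  have "g \<in> P_k k" using g_bounded by (rule P_k_if_symmetric) (rule g_sym)
  then have "g \<in> P_as" unfolding P_as_def by (rule UN_I[OF UNIV_I])
  moreover have "g' = g" if g': "g' \<in> P_as" "\<forall>n\<ge>k. truncate n g' = W_fin k n (truncate n f)" for g'
  proof
    fix m :: monom
    let ?n = "k + Poly_Mapping.degree m"
    have "truncate ?n g' = truncate ?n g" using g'(2) g_truncate by simp
    then have "Poly_Mapping.lookup (truncate ?n g') m = Poly_Mapping.lookup (truncate ?n g) m" by simp
    then show "g' m = g m"
      using keys_subset_degree[of m k]
      by (simp add: lookup_truncate g_bounded bounded_degree_P_as[OF g'(1)])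
  qed
  ultimately have "W k f = g"
    unfolding W_def using g_truncate by (intro the_equality) blast+
  then show "bounded_degree (W k f)"
    and "\<And>n. k \<le> n \<Longrightarrow> truncate n (W k f) = W_fin k n (truncate n f)"
    and "\<And>n \<sigma> m. \<sigma> permutes {k..<n} \<Longrightarrow> W k f (Poly_Mapping.map_key \<sigma> m) = W k f m"
    using g_bounded g_truncate g_sym by simp_all
qed

section \<open>Truncations of almost symmetric Schur functions are key polynomials\<close>

lemma is_key_append_zeros: "is_key \<alpha> f \<Longrightarrow> is_key (\<alpha> @ replicate n 0) f"
proof (induction rule: is_key.induct)
  case (dominant \<alpha>)
  have "x_pow \<alpha> = x_pow (\<alpha> @ replicate n 0)" by (simp add: x_pow_def)
  moreover have "sorted_wrt (\<ge>) (replicate n (0::nat))"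
    by (simp add: sorted_wrt_iff_nth_less)
  with dominant have "sorted_wrt (\<ge>) (\<alpha> @ replicate n 0)"
    by (auto simp: sorted_wrt_append)
  ultimately show ?case using is_key.dominant by metis
next
  case (swap \<alpha> f i)
  have "is_key ((\<alpha> @ replicate n 0)[i := (\<alpha> @ replicate n 0) ! Suc i, Suc i := (\<alpha> @ replicate n 0) ! i]) (xi i f)"
    using swap by (intro is_key.swap) (simp_all add: nth_append)
  then show ?case using swap by (simp add: nth_append list_update_append)
qed

lemma cut_key_poly: "cut (length \<alpha>) (key_poly \<alpha>) = key_poly \<alpha>"
  using is_key_key_poly[of \<alpha>]
proof (induction rule: is_key.induct)
  case (dominant \<alpha>)
  have "Poly_Mapping.keys (Poly_Mapping.nth \<alpha>) \<subseteq> {..<length \<alpha>}"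
    by (auto simp del: keys_nth simp: in_keys_iff nth_default_def split: if_splits)
  then show ?case
    by (intro poly_mapping_eqI)
      (auto simp del: keys_nth simp: lookup_select x_pow_def lookup_single when_def)
next
  case (swap \<alpha> f i)
  then show ?case by (simp add: cut_xi)
qed

lemma lookup_key_poly_zero:
  "\<not> Poly_Mapping.keys m \<subseteq> {..<length \<mu>} \<Longrightarrow> Poly_Mapping.lookup (key_poly \<mu>) m = 0"
  using cut_key_poly by (metis lookup_select)

lemma lookup_key_poly_map_key:
  assumes \<sigma>: "\<sigma> permutes {length \<mu>..<n}"
  shows "Poly_Mapping.lookup (key_poly \<mu>) (Poly_Mapping.map_key \<sigma> m) = Poly_Mapping.lookup (key_poly \<mu>) m"
proof -
  let ?r = "length \<mu>"
  have inj: "inj \<sigma>" and bij: "bij \<sigma>" using \<sigma> by (simp_all add: permutes_inj permutes_bij)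
  have fixed: "\<sigma> i = i" if "i < ?r" for i using permutes_not_in[OF \<sigma>, of i] that by simp
  show ?thesis
  proof (cases "Poly_Mapping.keys m \<subseteq> {..<?r}")
    case True
    have "Poly_Mapping.map_key \<sigma> m = m"
    proof (rule poly_mapping_eqI)
      fix i
      show "Poly_Mapping.lookup (Poly_Mapping.map_key \<sigma> m) i = Poly_Mapping.lookup m i"
      proof (cases "i < ?r")
        case False
        then have "\<not> \<sigma> i < ?r" using fixed inj by (metis injD)
        with False True have "i \<notin> Poly_Mapping.keys m" "\<sigma> i \<notin> Poly_Mapping.keys m" by auto
        then show ?thesis by (simp add: lookup_map_key[OF inj] in_keys_iff)
      qed (simp add: lookup_map_key[OF inj] fixed)
    qed
    then show ?thesis by simp
  next
    case False
    then obtain j where j: "j \<in> Poly_Mapping.keys m" "\<not> j < ?r" by auto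
    obtain i where i: "\<sigma> i = j" using bij by (metis bij_pointE)
    then have "\<not> i < ?r" using j fixed by metis
    moreover have "i \<in> Poly_Mapping.keys (Poly_Mapping.map_key \<sigma> m)"
      using i j by (simp add: keys_map_key[OF inj])
    ultimately have "\<not> Poly_Mapping.keys (Poly_Mapping.map_key \<sigma> m) \<subseteq> {..<?r}" by auto
    then show ?thesis using False by (simp add: lookup_key_poly_zero)
  qed
qed

lemma truncate_key_poly:
  assumes "length \<mu> \<le> n"
  shows "truncate n (Poly_Mapping.lookup (key_poly \<mu>)) = key_poly (\<mu> @ replicate (n - length \<mu>) 0)"
proof -
  have "truncate n (Poly_Mapping.lookup (key_poly \<mu>)) = key_poly \<mu>"
  proof (rule poly_mapping_eqI)
    fix m
    show "Poly_Mapping.lookup (truncate n (Poly_Mapping.lookup (key_poly \<mu>))) m = Poly_Mapping.lookup (key_poly \<mu>) m"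
      using lookup_key_poly_zero[of m \<mu>] assms
      by (cases "Poly_Mapping.keys m \<subseteq> {..<length \<mu>}")
        (auto simp: lookup_truncate bounded_degree_lookup)
  qed
  also have "\<dots> = key_poly (\<mu> @ replicate (n - length \<mu>) 0)"
    using is_key_append_zeros[OF is_key_key_poly] by (intro key_poly_eqI[symmetric])
  finally show ?thesis .
qed

text \<open>
  Appending zeros to the index does not change a key polynomial, so the claim about truncations holds
  for \<open>\<nu> = []\<close>.  Each application of \<open>W\<close> acts on a truncation as a product of operators \<open>xi i\<close>,
  and these map key polynomials to key polynomials.  The bound on \<open>n\<close> ensures that the initial key
  polynomial involves no variable that the truncation removes.
\<close>

lemma schur_as_limit_of_key_polys:
  "bounded_degree (schur_as \<mu> \<nu>) \<and>
    (\<forall>n \<sigma> m. \<sigma> permutes {length \<mu>..<n} \<longrightarrow> schur_as \<mu> \<nu> (Poly_Mapping.map_key \<sigma> m) = schur_as \<mu> \<nu> m) \<and>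
    (\<forall>n\<ge>length \<mu> + length \<nu>. truncate n (schur_as \<mu> \<nu>) \<in> key_poly ` {\<alpha>. length \<alpha> = n})"
proof (induction \<nu> arbitrary: \<mu>)
  case Nil
  then show ?case
    by (auto simp: bounded_degree_lookup lookup_key_poly_map_key truncate_key_poly)
next
  case (Cons a \<nu>)
  from Cons.IH[of "\<mu> @ [a]"] have bounded: "bounded_degree (schur_as (\<mu> @ [a]) \<nu>)"
    and key: "\<And>n. length \<mu> + length (a # \<nu>) \<le> n \<Longrightarrow>
      truncate n (schur_as (\<mu> @ [a]) \<nu>) \<in> key_poly ` {\<alpha>. length \<alpha> = n}"
    by simp_all
  note W = W_limit[OF bounded, where k = "length \<mu>"]
  have "truncate n (schur_as \<mu> (a # \<nu>)) \<in> key_poly ` {\<alpha>. length \<alpha> = n}"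
    if n: "length \<mu> + length (a # \<nu>) \<le> n" for n
  proof -
    from n obtain d where d: "n = length \<mu> + d" using le_Suc_ex[of "length \<mu>" n] by auto
    have "symmetrizer (length \<mu>) d (truncate n (schur_as (\<mu> @ [a]) \<nu>)) \<in> key_poly ` {\<alpha>. length \<alpha> = n}"
      using d by (intro symmetrizer_preserves_key_polys key[OF n]) simp
    then show ?thesis using W(2)[of n] by (simp add: d W_fin_eq_symmetrizer)
  qed
  then show ?case using W(1,3) by simp
qed

lemmas bounded_degree_schur_as = schur_as_limit_of_key_polys[THEN conjunct1]
  and schur_as_symmetric = schur_as_limit_of_key_polys[THEN conjunct2, THEN conjunct1, rule_format]
  and truncate_schur_as = schur_as_limit_of_key_polys[THEN conjunct2, THEN conjunct2, rule_format]

text \<open>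
  Every coefficient is already visible in some truncation, that is, in a key polynomial.
\<close>

lemma schur_as_coeff_nat: "schur_as \<mu> \<nu> m \<in> \<nat>"
proof -
  let ?n = "(length \<mu> + length \<nu>) + Poly_Mapping.degree m"
  obtain \<alpha> where "truncate ?n (schur_as \<mu> \<nu>) = key_poly \<alpha>"
    using truncate_schur_as[of \<mu> \<nu> ?n] by auto
  moreover have "schur_as \<mu> \<nu> m = Poly_Mapping.lookup (truncate ?n (schur_as \<mu> \<nu>)) m"
    using keys_subset_degree[of m "length \<mu> + length \<nu>"] by (simp add: lookup_truncate bounded_degree_schur_as)
  ultimately show ?thesis
    using nat_coeffs_key_poly by (simp add: nat_coeffs_def)
qed

section \<open>Coefficients in the monomial basis\<close>

definition low_part :: "nat \<Rightarrow> monom \<Rightarrow> nat list" where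
  "low_part r m = strip_while ((=) 0) (map (Poly_Mapping.lookup m) [0..<r])"

definition high_exponents :: "nat \<Rightarrow> monom \<Rightarrow> nat multiset" where
  "high_exponents r m = image_mset (Poly_Mapping.lookup m) (mset_set {i \<in> Poly_Mapping.keys m. r \<le> i})"

text \<open>
  The index of the unique basis element \<open>x\<^sup>\<alpha> m\<^sub>\<nu>\<close> in which the monomial \<open>m\<close> occurs: \<open>\<alpha>\<close> lists the
  exponents of the first \<open>r\<close> variables without trailing zeros, and \<open>\<nu>\<close> the nonzero exponents of
  the other variables in decreasing order.
\<close>

definition label :: "nat \<Rightarrow> monom \<Rightarrow> nat list \<times> nat list" where
  "label r m = (low_part r m, rev (sorted_list_of_multiset (high_exponents r m)))"

definition labels :: "nat \<Rightarrow> (nat list \<times> nat list) set" where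
  "labels r = {(\<alpha>, \<nu>) \<in> Sigma_as. length \<alpha> \<le> r}"

lemma nth_low_part: "Poly_Mapping.nth (low_part r m) = select (\<lambda>i. i < r) m"
  by (rule poly_mapping_eqI) (simp add: low_part_def lookup_select nth_default_def)

lemma low_part_eq_iff:
  assumes "reduced \<alpha>"
  shows "low_part r m = \<alpha> \<longleftrightarrow> select (\<lambda>i. i < r) m = Poly_Mapping.nth \<alpha>"
proof
  have strip: "strip_while ((=) 0) \<alpha> = \<alpha>"
    using assms by (auto simp: reduced_def strip_while_idem_iff no_trailing_unfold)
  assume "select (\<lambda>i. i < r) m = Poly_Mapping.nth \<alpha>"
  then have "Poly_Mapping.nth (map (Poly_Mapping.lookup m) [0..<r]) = Poly_Mapping.nth \<alpha>"
    by (simp add: nth_low_part[symmetric] low_part_def)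
  then show "low_part r m = \<alpha>"
    by (simp add: nth_eq_iff low_part_def strip)
qed (metis nth_low_part)

lemma high_part_eq_iff:
  assumes "is_partition \<nu>"
  shows "rev (sorted_list_of_multiset (high_exponents r m)) = \<nu> \<longleftrightarrow> high_exponents r m = mset \<nu>"
proof
  assume "high_exponents r m = mset \<nu>"
  then have "sorted_list_of_multiset (high_exponents r m) = sort \<nu>" by simp
  also have "\<dots> = rev \<nu>"
    using assms by (intro properties_for_sort) (simp_all add: is_partition_def sorted_wrt_rev)
  finally show "rev (sorted_list_of_multiset (high_exponents r m)) = \<nu>" by simp
next
  assume "rev (sorted_list_of_multiset (high_exponents r m)) = \<nu>"
  then show "high_exponents r m = mset \<nu>" by (metis mset_rev mset_sorted_list_of_multiset)
qed

lemma label_in_labels: "label r m \<in> labels r"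
proof -
  have "reduced (low_part r m)"
    using no_trailing_strip_while[of "(=) 0" "map (Poly_Mapping.lookup m) [0..<r]"]
    by (auto simp: reduced_def low_part_def no_trailing_unfold)
  moreover have "length (low_part r m) \<le> r"
    using length_strip_while_le[of "(=) 0" "map (Poly_Mapping.lookup m) [0..<r]"]
    by (simp add: low_part_def)
  moreover have "is_partition (rev (sorted_list_of_multiset (high_exponents r m)))"
    by (auto simp: is_partition_def sorted_wrt_rev high_exponents_def in_keys_iff)
  ultimately show ?thesis by (simp add: labels_def Sigma_as_def label_def)
qed

lemma coeff_x_pow_msym:
  assumes "(\<alpha>, \<nu>) \<in> labels r"
  shows "series_mult (Poly_Mapping.lookup (x_pow \<alpha>)) (msym \<nu> r) m = (if label r m = (\<alpha>, \<nu>) then 1 else 0)"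
proof -
  from assms have \<alpha>: "reduced \<alpha>" "length \<alpha> \<le> r" and \<nu>: "is_partition \<nu>"
    by (simp_all add: labels_def Sigma_as_def)
  define u where "u = select (\<lambda>i. i < r) m"
  define v where "v = select (\<lambda>i. r \<le> i) m"
  have m: "m = u + v"
    by (rule poly_mapping_eqI) (simp add: u_def v_def lookup_add lookup_select)
  have keys_v: "Poly_Mapping.keys v = {i \<in> Poly_Mapping.keys m. r \<le> i}"
    by (simp add: v_def keys_select)
  have exps: "image_mset (Poly_Mapping.lookup v) (mset_set (Poly_Mapping.keys v)) = high_exponents r m"
    unfolding high_exponents_def keys_v
    by (intro image_mset_cong) (simp add: v_def lookup_select)
  have label: "label r m = (\<alpha>, \<nu>) \<longleftrightarrow> u = Poly_Mapping.nth \<alpha> \<and> high_exponents r m = mset \<nu>"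
    by (simp add: label_def low_part_eq_iff[OF \<alpha>(1)] high_part_eq_iff[OF \<nu>] u_def)
  show ?thesis
  proof (cases "u = Poly_Mapping.nth \<alpha>")
    case True
    have "msym \<nu> r v = (if high_exponents r m = mset \<nu> then 1 else 0)"
      using exps by (auto simp: msym_def keys_v)
    then show ?thesis
      unfolding label x_pow_def series_mult_single using True m by auto
  next
    case False
    have "\<not> Poly_Mapping.keys b \<subseteq> {r..}" if b: "m = Poly_Mapping.nth \<alpha> + b" for b
    proof
      assume b': "Poly_Mapping.keys b \<subseteq> {r..}"
      have "Poly_Mapping.lookup b i = 0" if "i < r" for i using that b' by (force simp: in_keys_iff)
      moreover have "Poly_Mapping.lookup (Poly_Mapping.nth \<alpha>) i = 0" if "\<not> i < r" for i
        using that \<alpha>(2) by (simp add: nth_default_def)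
      ultimately have "u = Poly_Mapping.nth \<alpha>"
        unfolding u_def b by (intro poly_mapping_eqI) (simp add: lookup_select lookup_add del: lookup_nth)
      with False show False by simp
    qed
    then show ?thesis
      unfolding label x_pow_def series_mult_single using False by (auto simp: msym_def)
  qed
qed

text \<open>
  The monomial with exponents \<open>\<alpha>\<close> from index \<open>0\<close> on and \<open>\<nu>\<close> from index \<open>r\<close> on.
\<close>

lemma label_surj:
  assumes "p \<in> labels r"
  obtains m where "label r m = p"
proof -
  obtain \<alpha> \<nu> where p: "p = (\<alpha>, \<nu>)" by force
  from assms have \<alpha>: "length \<alpha> \<le> r" and \<nu>: "\<And>a. a \<in> set \<nu> \<Longrightarrow> a \<ge> 1"
    by (auto simp: p labels_def Sigma_as_def is_partition_def)
  define b where "b = Poly_Mapping.nth (replicate r 0 @ \<nu>)"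
  have lookup_b: "Poly_Mapping.lookup b i = (if r \<le> i \<and> i < r + length \<nu> then \<nu> ! (i - r) else 0)" for i
    by (auto simp: b_def nth_default_def nth_append)
  have keys_b: "Poly_Mapping.keys b = (+) r ` {..<length \<nu>}"
  proof (rule set_eqI)
    fix i
    have "i \<in> (+) r ` {..<length \<nu>} \<longleftrightarrow> r \<le> i \<and> i < r + length \<nu>"
      by (auto simp: image_iff intro!: bexI[of _ "i - r"])
    moreover have "\<nu> ! (i - r) \<noteq> 0" if "r \<le> i" "i < r + length \<nu>"
      using \<nu>[of "\<nu> ! (i - r)"] that by (auto simp: nth_mem)
    ultimately show "i \<in> Poly_Mapping.keys b \<longleftrightarrow> i \<in> (+) r ` {..<length \<nu>}"
      by (auto simp: in_keys_iff lookup_b)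
  qed
  have "image_mset (Poly_Mapping.lookup b) (mset_set (Poly_Mapping.keys b))
      = image_mset (\<lambda>i. Poly_Mapping.lookup b (r + i)) (mset_set {..<length \<nu>})"
    unfolding keys_b by (subst image_mset_mset_set[symmetric]) (simp_all add: multiset.map_comp o_def)
  also have "\<dots> = image_mset ((!) \<nu>) (mset_set {..<length \<nu>})"
    by (intro image_mset_cong) (simp add: lookup_b)
  also have "\<dots> = mset (map ((!) \<nu>) [0..<length \<nu>])"
    by (simp add: lessThan_atLeast0)
  also have "\<dots> = mset \<nu>" by (simp add: map_nth)
  finally have "msym \<nu> r b = 1" by (auto simp: msym_def keys_b)
  then have "series_mult (Poly_Mapping.lookup (x_pow \<alpha>)) (msym \<nu> r) (Poly_Mapping.nth \<alpha> + b) \<noteq> 0"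
    unfolding x_pow_def series_mult_single by auto
  then have "label r (Poly_Mapping.nth \<alpha> + b) = p"
    using coeff_x_pow_msym[of \<alpha> \<nu> r] assms p by (auto split: if_splits)
  then show ?thesis using that by blast
qed

text \<open>
  Two monomials with the same label have the same exponents in the first \<open>r\<close> variables and, once zeros
  are counted, the same multiset of exponents in the variables from \<open>r\<close> to a common bound; a
  permutation of these variables therefore maps one to the other.
\<close>

lemma symmetric_series_cong:
  fixes s :: series
  assumes sym: "\<And>n \<sigma> m. \<sigma> permutes {r..<n} \<Longrightarrow> s (Poly_Mapping.map_key \<sigma> m) = s m"
    and eq: "label r m = label r m'"
  shows "s m = s m'"
proof -
  define n where "n = r + Poly_Mapping.degree m + Poly_Mapping.degree m'"
  let ?A = "{r..<n}"
  have low: "select (\<lambda>i. i < r) m = select (\<lambda>i. i < r) m'"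
    using eq by (metis label_def nth_low_part prod.inject)
  have high: "high_exponents r m = high_exponents r m'"
    using eq by (metis label_def prod.inject rev_is_rev_conv mset_sorted_list_of_multiset)
  have split: "image_mset (Poly_Mapping.lookup k) (mset_set ?A)
      = high_exponents r k + replicate_mset (card ?A - size (high_exponents r k)) 0"
    if k: "Poly_Mapping.keys k \<subseteq> {..<n}" for k
  proof -
    let ?H = "{i \<in> Poly_Mapping.keys k. r \<le> i}"
    have H: "?H \<subseteq> ?A" using k by auto
    have "mset_set ?A = mset_set (?H \<union> (?A - ?H))" using H by (simp add: Un_absorb1)
    also have "\<dots> = mset_set ?H + mset_set (?A - ?H)" by (rule mset_set_Union) auto
    finally have "image_mset (Poly_Mapping.lookup k) (mset_set ?A)
      = high_exponents r k + image_mset (Poly_Mapping.lookup k) (mset_set (?A - ?H))"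
      by (simp add: high_exponents_def)
    also have "image_mset (Poly_Mapping.lookup k) (mset_set (?A - ?H)) = image_mset (\<lambda>_. 0) (mset_set (?A - ?H))"
      by (intro image_mset_cong) (auto simp: in_keys_iff)
    also have "\<dots> = replicate_mset (card (?A - ?H)) 0" by (simp add: image_mset_const_eq)
    also have "card (?A - ?H) = card ?A - size (high_exponents r k)"
      using H by (simp add: card_Diff_subset high_exponents_def)
    finally show ?thesis .
  qed
  have k: "Poly_Mapping.keys m \<subseteq> {..<n}" "Poly_Mapping.keys m' \<subseteq> {..<n}"
    using keys_subset_degree[of m r] keys_subset_degree[of m' r] by (auto simp: n_def)
  then have "image_mset (Poly_Mapping.lookup m) (mset_set ?A) = image_mset (Poly_Mapping.lookup m') (mset_set ?A)"
    by (simp add: split high)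
  then obtain p where p: "p permutes ?A" "\<forall>i\<in>?A. Poly_Mapping.lookup m i = Poly_Mapping.lookup m' (p i)"
    by (rule image_mset_eq_implies_permutes[OF finite_atLeastLessThan])
  have "m = Poly_Mapping.map_key p m'"
  proof (rule poly_mapping_eqI)
    fix i
    show "Poly_Mapping.lookup m i = Poly_Mapping.lookup (Poly_Mapping.map_key p m') i"
    proof (cases "i \<in> ?A")
      case True
      then show ?thesis using p by (simp add: lookup_map_key[OF permutes_inj])
    next
      case False
      have "Poly_Mapping.lookup m i = Poly_Mapping.lookup m' i"
      proof (cases "i < r")
        case True
        then show ?thesis using low by (metis lookup_select)
      next
        case *: False
        then have "i \<notin> Poly_Mapping.keys m" "i \<notin> Poly_Mapping.keys m'" using False k by auto
        then show ?thesis by (simp add: in_keys_iff)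
      qed
      then show ?thesis
        using p(1) permutes_not_in[OF p(1) False] by (simp add: lookup_map_key[OF permutes_inj])
    qed
  qed
  then show ?thesis using sym[OF p(1)] by simp
qed

lemma finite_labels_bounded_degree: "finite (label r ` {m. total_degree m \<le> d})"
proof (rule finite_subset)
  have le: "Poly_Mapping.lookup m j \<le> total_degree m" for m j
  proof (cases "j \<in> Poly_Mapping.keys m")
    case True
    then show ?thesis unfolding total_degree_def by (intro member_le_sum) auto
  qed (simp add: in_keys_iff)
  show "label r ` {m. total_degree m \<le> d}
    \<subseteq> {xs. set xs \<subseteq> {..d} \<and> length xs \<le> r} \<times> {xs. set xs \<subseteq> {..d} \<and> length xs \<le> d}"
  proof safe
    fix m assume m: "total_degree m \<le> d"
    fix \<alpha> \<nu> assume "(\<alpha>, \<nu>) = label r m"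
    then have \<alpha>: "\<alpha> = low_part r m" and \<nu>: "\<nu> = rev (sorted_list_of_multiset (high_exponents r m))"
      by (simp_all add: label_def)
    show "length \<alpha> \<le> r" using label_in_labels[of r m] by (simp add: labels_def \<alpha> label_def)
    have "set (low_part r m) \<subseteq> Poly_Mapping.lookup m ` UNIV"
    proof
      fix i assume "i \<in> set (low_part r m)"
      then have "i \<in> set (dropWhile ((=) 0) (rev (map (Poly_Mapping.lookup m) [0..<r])))"
        by (simp only: low_part_def strip_while_def o_apply set_rev)
      from set_dropWhileD[OF this] show "i \<in> Poly_Mapping.lookup m ` UNIV" by auto
    qed
    then have "i \<in> range (Poly_Mapping.lookup m)" if "i \<in> set \<alpha>" for i using that unfolding \<alpha> by blast
    then show "i \<le> d" if "i \<in> set \<alpha>" for i using that le[of m] m by (metis imageE order_trans)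
    show "i \<le> d" if "i \<in> set \<nu>" for i
      using that le[of m] m by (auto simp: \<nu> high_exponents_def intro: order_trans)
    have "length \<nu> = size (high_exponents r m)"
      by (metis \<nu> length_rev mset_sorted_list_of_multiset size_mset)
    also have "\<dots> = card {i \<in> Poly_Mapping.keys m. r \<le> i}"
      by (simp add: high_exponents_def)
    also have "\<dots> \<le> card (Poly_Mapping.keys m)" by (intro card_mono) auto
    also have "\<dots> \<le> total_degree m"
      unfolding total_degree_def card_eq_sum by (intro sum_mono) (simp add: in_keys_iff)
    finally show "length \<nu> \<le> d" using m by simp
  qed
  show "finite ({xs. set xs \<subseteq> {..d} \<and> length xs \<le> r} \<times> {xs. set xs \<subseteq> {..d} \<and> length xs \<le> d})"
    by (intro finite_cartesian_product finite_lists_length_le) auto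
qed

lemma expansion_coeff:
  assumes "finite {p. K p \<noteq> 0}" "{p. K p \<noteq> 0} \<subseteq> labels r"
  shows "(\<Sum>(\<alpha>, \<nu>) \<in> {p. K p \<noteq> 0}. K (\<alpha>, \<nu>) * series_mult (Poly_Mapping.lookup (x_pow \<alpha>)) (msym \<nu> r) m)
    = K (label r m)"
proof -
  have "(\<Sum>(\<alpha>, \<nu>) \<in> {p. K p \<noteq> 0}. K (\<alpha>, \<nu>) * series_mult (Poly_Mapping.lookup (x_pow \<alpha>)) (msym \<nu> r) m)
    = (\<Sum>p \<in> {p. K p \<noteq> 0}. if p = label r m then K p else 0)"
  proof (rule sum.cong[OF refl])
    fix p assume p: "p \<in> {p. K p \<noteq> 0}"
    obtain \<alpha> \<nu> where p_eq: "p = (\<alpha>, \<nu>)" by force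
    with p assms(2) have "(\<alpha>, \<nu>) \<in> labels r" by blast
    from coeff_x_pow_msym[OF this, of m]
    show "(case p of (\<alpha>, \<nu>) \<Rightarrow> K (\<alpha>, \<nu>) * series_mult (Poly_Mapping.lookup (x_pow \<alpha>)) (msym \<nu> r) m)
        = (if p = label r m then K p else 0)"
      by (auto simp: p_eq)
  qed
  also have "\<dots> = K (label r m)" using assms(1) by (simp add: sum.delta)
  finally show ?thesis .
qed

text \<open>
  The basis elements have disjoint sets of monomials, and all their nonzero coefficients are \<open>1\<close>; so the
  coefficient of a basis element in the expansion must be the coefficient of any one of its monomials in
  the series.  Conversely these values give an expansion because the series is symmetric in the variables
  from \<open>length \<mu>\<close> on, and a finite one because its degree is bounded.
\<close>

lemma kostka_as_eq:
  "kostka_as (\<mu>, lam) p =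
    (if p \<in> labels (length \<mu>) then schur_as \<mu> lam (SOME m. label (length \<mu>) m = p) else 0)"
proof -
  let ?r = "length \<mu>" and ?s = "schur_as \<mu> lam"
  define K where "K p = (if p \<in> labels ?r then ?s (SOME m. label ?r m = p) else 0)" for p
  have K_label: "K (label ?r m) = ?s m" for m
  proof -
    have "label ?r (SOME m'. label ?r m' = label ?r m) = label ?r m" by (rule someI) simp
    then have "?s (SOME m'. label ?r m' = label ?r m) = ?s m"
      by (rule symmetric_series_cong[rotated]) (rule schur_as_symmetric)
    then show ?thesis by (simp add: K_def label_in_labels)
  qed
  have K_labels: "{p. K p \<noteq> 0} \<subseteq> labels ?r" by (auto simp: K_def)
  obtain d where d: "\<And>m. ?s m \<noteq> 0 \<Longrightarrow> total_degree m \<le> d"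
    using bounded_degree_schur_as[of \<mu> lam] unfolding bounded_degree_def by blast
  have "{p. K p \<noteq> 0} \<subseteq> label ?r ` {m. total_degree m \<le> d}"
  proof
    fix p assume p: "p \<in> {p. K p \<noteq> 0}"
    with K_labels obtain m where "label ?r m = p" using label_surj by blast
    with p K_label d show "p \<in> label ?r ` {m. total_degree m \<le> d}" by auto
  qed
  then have K_finite: "finite {p. K p \<noteq> 0}"
    by (rule finite_subset) (rule finite_labels_bounded_degree)
  have "kostka_as (\<mu>, lam) = K"
    unfolding kostka_as_def prod.case labels_def[symmetric]
  proof (rule the_equality)
    show "finite {p. K p \<noteq> 0} \<and> {p. K p \<noteq> 0} \<subseteq> labels ?r \<and>
      ?s = (\<lambda>m. \<Sum>(\<alpha>, \<nu>) \<in> {p. K p \<noteq> 0}. K (\<alpha>, \<nu>) * series_mult (Poly_Mapping.lookup (x_pow \<alpha>)) (msym \<nu> ?r) m)"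
      by (simp only: K_finite K_labels expansion_coeff K_label simp_thms)
  next
    fix K' assume K': "finite {p. K' p \<noteq> 0} \<and> {p. K' p \<noteq> 0} \<subseteq> labels ?r \<and>
      ?s = (\<lambda>m. \<Sum>(\<alpha>, \<nu>) \<in> {p. K' p \<noteq> 0}. K' (\<alpha>, \<nu>) * series_mult (Poly_Mapping.lookup (x_pow \<alpha>)) (msym \<nu> ?r) m)"
    then have K'_label: "?s m = K' (label ?r m)" for m
      using expansion_coeff[of K' ?r m] by metis
    show "K' = K"
    proof
      fix p
      show "K' p = K p"
      proof (cases "p \<in> labels ?r")
        case True
        then obtain m where "label ?r m = p" by (rule label_surj)
        then show ?thesis using K_label K'_label by metis
      next
        case False
        then have "K' p = 0" "K p = 0" using K' K_labels by auto
        then show ?thesis by simp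
      qed
    qed
  qed
  then show ?thesis by (simp add: K_def)
qed

theorem theorem4p8:
  fixes \<mu> lam \<alpha> \<nu> :: "nat list"
  assumes "(\<mu>, lam) \<in> Sigma_as"
    and "(\<alpha>, \<nu>) \<in> Sigma_as"
  shows "kostka_as (\<mu>, lam) (\<alpha>, \<nu>) \<in> \<nat>"
  by (simp add: kostka_as_eq schur_as_coeff_nat)

end
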